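(* Let $V$ be a complex linear representation of the Lie supergroup $S^{1|1}$. Suppose that the representation of the reduced group $S^1$ on $V$ contains no trivial subrepresentations, and that for each $m\in\mathbb{Z}$ the super vector space $\{v\in V: t\cdot v=t^m v\ \text{for all } t\in S^1\}$ is finite-dimensional. Then $V$ is isomorphic to a direct sum of super weight spaces. In particular, if $V$ is irreducible and the weight of $S^1$ on $V$ is nonzero, then $V$ is a super weight space.
   Context: $S^{1|1}$ is the real Lie supergroup given by the super Harish-Chandra pair $(S^1,\mathfrak{g}^{1|1}_{\mathbb{R}})$, where $\mathfrak{g}^{1|1}_{\mathbb{R}}$ is the real form with even part $\mathbb{R}\,iC$ (unique up to isomorphism) of the complex Lie superalgebra $\mathfrak{g}^{1|1}$ with even basis element $C$, odd basis element $Z$ and brackets $[C,C]=[C,Z]=0$, $[Z,Z]=-2C$; explicitly, $\mathfrak{g}^{1|1}_{\mathbb{R}}=\mathrm{span}_{\mathbb{R}}\{iC,\,bZ\}$ with $b\ne 0$, $b/\overline{b}=i$. The group $S^1$ acts trivially on $\mathfrak{g}^{1|1}_{\mathbb{R}}$, and $iC$ corresponds to the standard generator of $\mathrm{Lie}(S^1)=i\mathbb{R}$. A complex representation of $S^{1|1}$ on a complex super vector space $V$ is a pair $(\pi,\rho^\pi)$ consisting of a parity-preserving complex linear representation $\pi$ of $S^1$ on $V$ and a Lie superalgebra representation $\rho^\pi$ of $\mathfrak{g}^{1|1}_{\mathbb{R}}$ on $V$ (extended $\mathbb{C}$-linearly to $C$ and $Z$, with $\rho^\pi(Z)$ odd),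 such that $\rho^\pi$ restricted to the even part is the differential of $\pi$, and $\rho^\pi(g\cdot X)=\pi(g)\rho^\pi(X)\pi(g)^{-1}$ for $g\in S^1$ and $X\in\mathfrak{g}^{1|1}_{\mathbb{R}}$. For $m\in\mathbb{Z}$, $m\neq0$, a super weight space of weight $m$ is a $1|1$-dimensional complex representation of $S^{1|1}$ on which $t\in S^1$ acts as multiplication by $t^m$, $C$ acts as multiplication by $m$, and there is a homogeneous basis $v_0,v_1$ in which $Z$ acts by the matrix $\begin{pmatrix}0&\sqrt{-m}\\ \sqrt{-m}&0\end{pmatrix}$, for a choice of square root of $-m$ (the two choices give isomorphic representations). *)

theory Defs
  imports "HOL-Analysis.Analysis" "HOL-Library.Function_Algebras" "HOL-Library.Z2"
begin

section \<open>Complex vector spaces\<close>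

class complex_vector = ab_group_add +
  fixes scaleC :: "complex \<Rightarrow> 'a \<Rightarrow> 'a" (infixr "*\<^sub>C" 75)
  assumes scaleC_add_right: "a *\<^sub>C (x + y) = a *\<^sub>C x + a *\<^sub>C y"
    and scaleC_add_left: "(a + b) *\<^sub>C x = a *\<^sub>C x + b *\<^sub>C x"
    and scaleC_scaleC: "a *\<^sub>C b *\<^sub>C x = (a * b) *\<^sub>C x"
    and scaleC_one: "1 *\<^sub>C x = x"

interpretation complex_vector: vector_space "scaleC :: complex \<Rightarrow> 'a \<Rightarrow> 'a::complex_vector"
  by unfold_locales
    (rule scaleC_add_right scaleC_add_left scaleC_scaleC scaleC_one)+

instantiation complex :: complex_vector
begin
definition scaleC_complex_def: "a *\<^sub>C (x::complex) = a * x"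
instance by standard (simp_all add: scaleC_complex_def algebra_simps)
end

instantiation prod :: (complex_vector, complex_vector) complex_vector
begin
definition scaleC_prod_def: "a *\<^sub>C x = (a *\<^sub>C fst x, a *\<^sub>C snd x)"
instance
  by standard (simp_all add: scaleC_prod_def scaleC_add_right scaleC_add_left
      scaleC_scaleC scaleC_one)
end

instantiation "fun" :: (type, complex_vector) complex_vector
begin
definition scaleC_fun_def: "a *\<^sub>C f = (\<lambda>i. a *\<^sub>C f i)"
instance
  by standard (simp_all add: scaleC_fun_def fun_eq_iff scaleC_add_right scaleC_add_left
      scaleC_scaleC scaleC_one)
end

definition linear_on :: "'a set \<Rightarrow> ('a::complex_vector \<Rightarrow> 'b::complex_vector) \<Rightarrow> bool" where
  "linear_on S f \<longleftrightarrow>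
     (\<forall>x\<in>S. \<forall>y\<in>S. f (x + y) = f x + f y) \<and> (\<forall>c. \<forall>x\<in>S. f (c *\<^sub>C x) = c *\<^sub>C f x)"

definition finite_dim :: "'a::complex_vector set \<Rightarrow> bool" where
  "finite_dim S \<longleftrightarrow> (\<exists>B. finite B \<and> S \<subseteq> complex_vector.span B)"


section \<open>The super Harish-Chandra pair\<close>

definition S1 :: "complex set" where
  "S1 = sphere 0 1"

text \<open>The pair \<open>(c, z)\<close> stands for \<open>c C + z Z\<close>; the bracket is determined by
  \<open>[C, C] = [C, Z] = 0\<close> and \<open>[Z, Z] = - 2 C\<close>. Parities are elements of the two-element
  field \<open>bit\<close>.\<close>

type_synonym g11 = "complex \<times> complex"

definition gen_C :: g11 where "gen_C = (1, 0)"
definition gen_Z :: g11 where "gen_Z = (0, 1)"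

definition g11_bracket :: "g11 \<Rightarrow> g11 \<Rightarrow> g11" where
  "g11_bracket X Y = (- 2 * snd X * snd Y, 0)"

definition g11_part :: "bit \<Rightarrow> g11 set" where
  "g11_part p = (if p = 0 then {X. snd X = 0} else {X. fst X = 0})"

text \<open>The real form is the real span of \<open>\<i> C\<close> and \<open>b Z\<close> with \<open>b = 1 + \<i>\<close>. All
  \<open>b \<noteq> 0\<close> with \<open>b / cnj b = \<i>\<close> give the same real span.\<close>

definition g11_real :: "g11 set" where
  "g11_real = {X. \<exists>a s :: real. X = (of_real a * \<i>) *\<^sub>C gen_C + (of_real s * (1 + \<i>)) *\<^sub>C gen_Z}"

lemma g11_real_eq:
  assumes "b \<noteq> 0" "b / cnj b = \<i>"
  shows "g11_real = {X. \<exists>a s :: real. X = (of_real a * \<i>) *\<^sub>C gen_C + (of_real s * b) *\<^sub>C gen_Z}"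
proof -
  have "b = \<i> * cnj b" using assms by (simp add: field_simps)
  then have "Re b = Im b" by (metis Re_i_times cnj.sel(2) minus_minus)
  define r where "r = Re b"
  have b: "b = of_real r * (1 + \<i>)"
    using \<open>Re b = Im b\<close> by (simp add: r_def complex_eq_iff)
  with assms(1) have r: "r \<noteq> 0" by auto
  have 1: "\<exists>s'. of_real s * (1 + \<i>) = of_real s' * b" for s :: real
    by (rule exI[of _ "s / r"]) (simp add: b r)
  have 2: "\<exists>s'. of_real s * b = of_real s' * (1 + \<i>)" for s :: real
    by (rule exI[of _ "s * r"]) (simp add: b)
  show ?thesis
  proof (intro set_eqI iffI)
    fix X assume "X \<in> g11_real"
    then obtain a s :: real where "X = (of_real a * \<i>) *\<^sub>C gen_C + (of_real s * (1 + \<i>)) *\<^sub>C gen_Z"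
      unfolding g11_real_def by blast
    moreover obtain s' :: real where "of_real s * (1 + \<i>) = of_real s' * b" using 1 by blast
    ultimately have "X = (of_real a * \<i>) *\<^sub>C gen_C + (of_real s' * b) *\<^sub>C gen_Z" by simp
    then show "X \<in> {X. \<exists>a s :: real. X = (of_real a * \<i>) *\<^sub>C gen_C + (of_real s * b) *\<^sub>C gen_Z}"
      by blast
  next
    fix X assume "X \<in> {X. \<exists>a s :: real. X = (of_real a * \<i>) *\<^sub>C gen_C + (of_real s * b) *\<^sub>C gen_Z}"
    then obtain a s :: real where X: "X = (of_real a * \<i>) *\<^sub>C gen_C + (of_real s * b) *\<^sub>C gen_Z"
      by blast
    obtain s' :: real where "of_real s * b = of_real s' * (1 + \<i>)" using 2 by blast
    with X have "X = (of_real a * \<i>) *\<^sub>C gen_C + (of_real s' * (1 + \<i>)) *\<^sub>C gen_Z" by simp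
    then show "X \<in> g11_real"
      unfolding g11_real_def by blast
  qed
qed


section \<open>Representations\<close>

text \<open>A representation lives on a complex subspace \<open>rep_space\<close> of the ambient type. Its
  Lie superalgebra part \<open>rep_alg\<close> is recorded on the complexification, as the
  \<open>\<complex>\<close>-linear extension from the real form.\<close>

record 'v s11_rep =
  rep_space :: "'v set"
  rep_part :: "bit \<Rightarrow> 'v set"
  rep_grp :: "complex \<Rightarrow> 'v \<Rightarrow> 'v"
  rep_alg :: "g11 \<Rightarrow> 'v \<Rightarrow> 'v"

definition super_space :: "'v::complex_vector set \<Rightarrow> (bit \<Rightarrow> 'v set) \<Rightarrow> bool" where
  "super_space S P \<longleftrightarrow>
     complex_vector.subspace S \<and> (\<forall>p. complex_vector.subspace (P p)) \<and>
     S = {x + y | x y. x \<in> P 0 \<and> y \<in> P 1} \<and> P 0 \<inter> P 1 = {0}"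

definition S1_rep :: "'v::complex_vector s11_rep \<Rightarrow> bool" where
  "S1_rep V \<longleftrightarrow>
     (\<forall>t\<in>S1. linear_on (rep_space V) (rep_grp V t)) \<and>
     (\<forall>t\<in>S1. \<forall>p. \<forall>v\<in>rep_part V p. rep_grp V t v \<in> rep_part V p) \<and>
     (\<forall>v\<in>rep_space V. rep_grp V 1 v = v) \<and>
     (\<forall>s\<in>S1. \<forall>t\<in>S1. \<forall>v\<in>rep_space V. rep_grp V (s * t) v = rep_grp V s (rep_grp V t v))"

definition g11_rep :: "'v::complex_vector s11_rep \<Rightarrow> bool" where
  "g11_rep V \<longleftrightarrow>
     (\<forall>X. linear_on (rep_space V) (rep_alg V X)) \<and>
     (\<forall>v\<in>rep_space V. linear_on UNIV (\<lambda>X. rep_alg V X v)) \<and>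
     (\<forall>p q. \<forall>X \<in> g11_real \<inter> g11_part p. \<forall>v\<in>rep_part V q. rep_alg V X v \<in> rep_part V (p + q)) \<and>
     (\<forall>p q. \<forall>X \<in> g11_real \<inter> g11_part p. \<forall>Y \<in> g11_real \<inter> g11_part q. \<forall>v\<in>rep_space V.
        rep_alg V (g11_bracket X Y) v =
          rep_alg V X (rep_alg V Y v)
            - (if p = 1 \<and> q = 1 then - 1 else 1) *\<^sub>C rep_alg V Y (rep_alg V X v))"

text \<open>\<open>V\<close> carries no topology. That \<open>\<rho>(\<i> C)\<close> is the derivative of \<open>\<pi>\<close> at the
  identity in the direction \<open>\<i> \<in> Lie(S\<^sup>1)\<close> means that every matrix coefficient
  \<open>\<theta> \<mapsto> \<phi> (\<pi> (exp (\<i> \<theta>)) v)\<close>, with \<open>\<phi>\<close> any linear functional on \<open>V\<close>, has derivative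
  \<open>\<phi> (\<rho>(\<i> C) v)\<close> at \<open>0\<close>. By the group law the matrix coefficients are then smooth. If
  \<open>V\<close> is finite-dimensional, this is the usual differential.\<close>

definition is_differential :: "'v::complex_vector s11_rep \<Rightarrow> bool" where
  "is_differential V \<longleftrightarrow>
     (\<forall>v\<in>rep_space V. \<forall>\<phi> :: 'v \<Rightarrow> complex. linear_on (rep_space V) \<phi> \<longrightarrow>
        ((\<lambda>\<theta>::real. \<phi> (rep_grp V (cis \<theta>) v))
           has_vector_derivative \<phi> (rep_alg V (\<i> *\<^sub>C gen_C) v)) (at 0))"

text \<open>The last clause is \<open>\<rho>(g \<cdot> X) = \<pi>(g) \<rho>(X) \<pi>(g)\<^sup>-\<^sup>1\<close>, where \<open>S\<^sup>1\<close> acts trivially on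
  the Lie superalgebra.\<close>

definition s11_representation :: "'v::complex_vector s11_rep \<Rightarrow> bool" where
  "s11_representation V \<longleftrightarrow>
     super_space (rep_space V) (rep_part V) \<and> S1_rep V \<and> g11_rep V \<and> is_differential V \<and>
     (\<forall>t\<in>S1. \<forall>X\<in>g11_real. \<forall>v\<in>rep_space V.
        rep_alg V X v = rep_grp V t (rep_alg V X (rep_grp V (inverse t) v)))"

definition s11_iso :: "'v::complex_vector s11_rep \<Rightarrow> 'w::complex_vector s11_rep \<Rightarrow> bool" where
  "s11_iso V W \<longleftrightarrow>
     (\<exists>f. linear_on (rep_space V) f \<and> bij_betw f (rep_space V) (rep_space W) \<and>
        (\<forall>p. f ` rep_part V p = rep_part W p) \<and>
        (\<forall>t\<in>S1. \<forall>v\<in>rep_space V. f (rep_grp V t v) = rep_grp W t (f v)) \<and>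
        (\<forall>X. \<forall>v\<in>rep_space V. f (rep_alg V X v) = rep_alg W X (f v)))"

definition direct_sum :: "'i set \<Rightarrow> ('i \<Rightarrow> 'w::complex_vector s11_rep) \<Rightarrow> ('i \<Rightarrow> 'w) s11_rep" where
  "direct_sum I W = \<lparr>
     rep_space = {f. finite {i. f i \<noteq> 0} \<and> (\<forall>i\<in>I. f i \<in> rep_space (W i)) \<and> (\<forall>i. i \<notin> I \<longrightarrow> f i = 0)},
     rep_part = (\<lambda>p. {f. finite {i. f i \<noteq> 0} \<and> (\<forall>i\<in>I. f i \<in> rep_part (W i) p) \<and> (\<forall>i. i \<notin> I \<longrightarrow> f i = 0)}),
     rep_grp = (\<lambda>t f i. if i \<in> I then rep_grp (W i) t (f i) else 0),
     rep_alg = (\<lambda>X f i. if i \<in> I then rep_alg (W i) X (f i) else 0)\<rparr>"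

definition subrepresentation :: "'v::complex_vector set \<Rightarrow> 'v s11_rep \<Rightarrow> bool" where
  "subrepresentation U V \<longleftrightarrow>
     U \<subseteq> rep_space V \<and> super_space U (\<lambda>p. U \<inter> rep_part V p) \<and>
     (\<forall>t\<in>S1. \<forall>u\<in>U. rep_grp V t u \<in> U) \<and>
     (\<forall>X. \<forall>u\<in>U. rep_alg V X u \<in> U)"

definition irreducible_rep :: "'v::complex_vector s11_rep \<Rightarrow> bool" where
  "irreducible_rep V \<longleftrightarrow>
     rep_space V \<noteq> {0} \<and> (\<forall>U. subrepresentation U V \<longrightarrow> U = {0} \<or> U = rep_space V)"

text \<open>This concerns the reduced group only, so the subspaces need not be graded.\<close>

definition no_trivial_S1_subrep :: "'v::complex_vector s11_rep \<Rightarrow> bool" where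
  "no_trivial_S1_subrep V \<longleftrightarrow>
     (\<forall>U. complex_vector.subspace U \<and> U \<subseteq> rep_space V \<and> (\<forall>t\<in>S1. \<forall>u\<in>U. rep_grp V t u = u)
        \<longrightarrow> U = {0})"

definition weight_space :: "'v::complex_vector s11_rep \<Rightarrow> int \<Rightarrow> 'v set" where
  "weight_space V m = {v \<in> rep_space V. \<forall>t\<in>S1. rep_grp V t v = (t powi m) *\<^sub>C v}"

definition is_weight :: "'v::complex_vector s11_rep \<Rightarrow> int \<Rightarrow> bool" where
  "is_weight V m \<longleftrightarrow> (\<exists>v\<in>weight_space V m. v \<noteq> 0)"

text \<open>Below, \<open>r\<close> is either of the two square roots of \<open>- m\<close>.\<close>

definition super_weight_space :: "int \<Rightarrow> 'v::complex_vector s11_rep \<Rightarrow> bool" where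
  "super_weight_space m V \<longleftrightarrow>
     m \<noteq> 0 \<and> s11_representation V \<and>
     complex_vector.dim (rep_part V 0) = 1 \<and> complex_vector.dim (rep_part V 1) = 1 \<and>
     (\<forall>t\<in>S1. \<forall>v\<in>rep_space V. rep_grp V t v = (t powi m) *\<^sub>C v) \<and>
     (\<forall>v\<in>rep_space V. rep_alg V gen_C v = of_int m *\<^sub>C v) \<and>
     (\<exists>v0 v1 r. r\<^sup>2 = - of_int m \<and>
        rep_part V 0 = complex_vector.span {v0} \<and> rep_part V 1 = complex_vector.span {v1} \<and>
        rep_alg V gen_Z v0 = r *\<^sub>C v1 \<and> rep_alg V gen_Z v1 = r *\<^sub>C v0)"

end

theory Submission
  imports Defs "HOL-Computational_Algebra.Fundamental_Theorem_Algebra"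
begin

text \<open>Let \<open>A\<close> be the action of \<open>\<i> C\<close>. Since matrix coefficients are continuous for all linear
  functionals, a short piece of the orbit of any \<open>v\<close> spans a finite-dimensional space; it contains
  all derivatives \<open>A\<^sup>n v\<close>, so a nonzero polynomial in \<open>A\<close> annihilates \<open>v\<close>. Periodicity of
  \<open>\<theta> \<mapsto> \<pi> (exp (\<i> \<theta>))\<close> forces the eigenvalues of \<open>A\<close> into \<open>\<i> \<int>\<close> and excludes Jordan blocks, so
  \<open>V\<close> is the sum of its weight spaces. On weight \<open>m \<noteq> 0\<close> we have \<open>Z\<^sup>2 = - m\<close>, so \<open>Z\<close> is invertible and
  each even weight vector \<open>v\<close> spans, together with \<open>Z v\<close>, a super weight space. A basis of the even part
  made of weight vectors gives the decomposition; it is countable because the weight spaces are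
  finite-dimensional.\<close>


section \<open>Linear maps and functionals\<close>

text \<open>The obstacle is that \<open>V\<close> carries no topology and may have infinite
  dimension, so no differential equation can be solved in \<open>V\<close> itself. Each analytic
  step is carried out on a scalar matrix coefficient and is transported back because linear
  functionals, prescribed freely on algebraic bases, separate points and separate a vector from a
  subspace. The functionals in \<open>is_differential\<close> are arbitrary, and it is the badly
  behaved ones among them that force short pieces of orbits into finite-dimensional spaces.

  A basis of the even part suffices because, once weight 0 is excluded, Z carries the even part onto
  the odd part. The irreducible case bypasses the spectral argument: a weight vector is given there,
  and it is enough to exhibit a two-dimensional subrepresentation.\<close>

lemma linear_on_add: "linear_on S f \<Longrightarrow> x \<in> S \<Longrightarrow> y \<in> S \<Longrightarrow> f (x + y) = f x + f y"
  and linear_on_scale: "linear_on S f \<Longrightarrow> x \<in> S \<Longrightarrow> f (c *\<^sub>C x) = c *\<^sub>C f x"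
  by (auto simp: linear_on_def)

lemma linear_on_zero:
  assumes "linear_on S f" "complex_vector.subspace S"
  shows "f 0 = 0"
  using linear_on_scale[OF assms(1) complex_vector.subspace_0[OF assms(2)], of 0] by simp

lemma linear_on_diff:
  assumes "linear_on S f" "complex_vector.subspace S" "x \<in> S" "y \<in> S"
  shows "f (x - y) = f x - f y"
proof -
  have "f (x - y) + f y = f x"
    using linear_on_add[OF assms(1) complex_vector.subspace_diff[OF assms(2-4)] assms(4)] by simp
  then show ?thesis by (simp add: algebra_simps)
qed

lemma linear_on_sum:
  assumes "linear_on S f" "complex_vector.subspace S" "\<And>i. i \<in> J \<Longrightarrow> x i \<in> S"
  shows "f (\<Sum>i\<in>J. x i) = (\<Sum>i\<in>J. f (x i))"
  using assms(3)
proof (induction J rule: infinite_finite_induct)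
  case (insert i J)
  have "(\<Sum>i\<in>J. x i) \<in> S"
    using insert.prems by (intro complex_vector.subspace_sum[OF assms(2)]) auto
  with insert show ?case by (simp add: linear_on_add[OF assms(1)])
qed (simp_all add: linear_on_zero[OF assms(1,2)])

lemma linear_on_span_eq:
  assumes f: "linear_on S f" "linear_on S g" and S: "complex_vector.subspace S" "B \<subseteq> S"
    and eq: "\<And>b. b \<in> B \<Longrightarrow> f b = g b" and v: "v \<in> complex_vector.span B"
  shows "f v = g v"
proof -
  have "complex_vector.span B \<subseteq> {v \<in> S. f v = g v}"
    using S eq complex_vector.subspace_0[OF S(1)] complex_vector.subspace_add[OF S(1)]
      complex_vector.subspace_scale[OF S(1)]
    by (intro complex_vector.span_minimal complex_vector.subspaceI)
      (auto simp: linear_on_add[OF f(1)] linear_on_add[OF f(2)] linear_on_zero[OF f(1) S(1)]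
        linear_on_zero[OF f(2) S(1)] linear_on_scale[OF f(1)] linear_on_scale[OF f(2)])
  with v show ?thesis by auto
qed

interpretation functional: vector_space_pair
  "scaleC :: complex \<Rightarrow> 'a \<Rightarrow> 'a::complex_vector" "scaleC :: complex \<Rightarrow> complex \<Rightarrow> complex"
  by unfold_locales

lemma ex_functional_on_independent:
  fixes B :: "'a::complex_vector set" and f :: "'a \<Rightarrow> complex"
  assumes "\<not> complex_vector.dependent B"
  shows "\<exists>\<phi>. linear_on UNIV \<phi> \<and> (\<forall>b\<in>B. \<phi> b = f b)"
proof -
  obtain \<phi> where "Vector_Spaces.linear scaleC scaleC \<phi>" "\<forall>b\<in>B. \<phi> b = f b"
    using functional.linear_independent_extend[OF assms] by blast
  then show ?thesis
    by (intro exI[of _ \<phi>]) (auto simp: linear_on_def functional.linear_add functional.linear_scale)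
qed

text \<open>A basis of the span of \<open>T\<close> stays independent when \<open>x\<close> is
  added, so the value 1 at \<open>x\<close> and 0 on the basis can be prescribed. This algebraic
  form of Hahn-Banach allows membership in a span to be tested on coefficients.\<close>

lemma ex_functional_separating:
  fixes x :: "'a::complex_vector"
  assumes "x \<notin> complex_vector.span T"
  shows "\<exists>\<phi> :: 'a \<Rightarrow> complex. linear_on UNIV \<phi> \<and> \<phi> x = 1 \<and> (\<forall>y\<in>complex_vector.span T. \<phi> y = 0)"
proof -
  obtain B where B: "B \<subseteq> T" "complex_vector.independent B" "T \<subseteq> complex_vector.span B"
    using complex_vector.maximal_independent_subset by blast
  have sp: "complex_vector.span T = complex_vector.span B"
    using B by (metis complex_vector.span_mono complex_vector.span_span subset_antisym)
  then have x: "x \<notin> complex_vector.span B" using assms by simp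
  then have "complex_vector.independent (insert x B)"
    using B(2) by (simp add: complex_vector.independent_insert)
  then obtain \<phi> where \<phi>: "linear_on UNIV \<phi>" "\<forall>b\<in>insert x B. \<phi> b = (if b = x then 1 else 0 :: complex)"
    using ex_functional_on_independent[of "insert x B" "\<lambda>b. if b = x then 1 else 0"] by blast
  have "x \<notin> B" using x complex_vector.span_base by blast
  then have "\<phi> b = 0" if "b \<in> B" for b using \<phi>(2) that by auto
  then have "\<phi> y = 0" if "y \<in> complex_vector.span B" for y
    using linear_on_span_eq[OF \<phi>(1), of "\<lambda>_. 0" B y] that by (auto simp: linear_on_def)
  with \<phi> sp show ?thesis by auto
qed

text \<open>Separation from the zero space, applied to \<open>x - y\<close>. It turns identities
  between matrix coefficients into identities between vectors.\<close>

lemma functionals_separate: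
  fixes x y :: "'a::complex_vector"
  assumes "\<And>\<phi> :: 'a \<Rightarrow> complex. linear_on UNIV \<phi> \<Longrightarrow> \<phi> x = \<phi> y"
  shows "x = y"
proof (rule ccontr)
  assume "x \<noteq> y"
  then have "x - y \<notin> complex_vector.span {}" by simp
  then obtain \<phi> :: "'a \<Rightarrow> complex" where \<phi>: "linear_on UNIV \<phi>" "\<phi> (x - y) = 1"
    using ex_functional_separating by blast
  then show False using assms[OF \<phi>(1)] linear_on_diff[OF \<phi>(1), of x y] by simp
qed

text \<open>A linear relation involves finitely many terms and so lies in an initial segment, which
  is independent by induction. Injectivity is recorded separately because independence of
  \<open>range x\<close> says nothing about repetitions.\<close>

lemma independent_sequence:
  fixes x :: "nat \<Rightarrow> 'a::complex_vector"
  assumes new: "\<And>n. x n \<notin> complex_vector.span (x ` {..<n})"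
  shows "inj x" "complex_vector.independent (range x)"
proof -
  show "inj x"
  proof (rule linorder_injI)
    fix i j :: nat assume "i < j"
    then have "x i \<in> complex_vector.span (x ` {..<j})"
      by (intro complex_vector.span_base) auto
    with new[of j] show "x i \<noteq> x j" by auto
  qed
  have ind: "complex_vector.independent (x ` {..<n})" for n
  proof (induction n)
    case 0
    then show ?case by (simp add: complex_vector.independent_empty)
  next
    case (Suc n)
    then show ?case using new[of n] by (simp add: lessThan_Suc complex_vector.independent_insert)
  qed
  have "range x = (\<Union>n. x ` {..<n})" by auto
  also have "complex_vector.independent \<dots>"
  proof (rule complex_vector.independent_Union_directed)
    fix c d assume "c \<in> range (\<lambda>n. x ` {..<n})" "d \<in> range (\<lambda>n. x ` {..<n})"
    then obtain i j where "c = x ` {..<i}" "d = x ` {..<j}" by auto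
    then show "c \<subseteq> d \<or> d \<subseteq> c"
      by (cases "i \<le> j") (auto intro!: image_mono)
  qed (use ind in auto)
  finally show "complex_vector.independent (range x)" .
qed

text \<open>Otherwise the sequence would be an infinite independent set in a finitely generated
  space. For the iterates of an operator at a vector this yields a polynomial relation.\<close>

lemma ex_in_span_of_earlier:
  fixes x :: "nat \<Rightarrow> 'a::complex_vector"
  assumes "finite B" "\<And>n. x n \<in> complex_vector.span B"
  shows "\<exists>n. x n \<in> complex_vector.span (x ` {..<n})"
proof (rule ccontr)
  assume "\<nexists>n. x n \<in> complex_vector.span (x ` {..<n})"
  then have "inj x" "complex_vector.independent (range x)"
    using independent_sequence[of x] by auto
  moreover have "finite (range x)"
    using complex_vector.independent_span_bound[OF assms(1) calculation(2)] assms(2) by auto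
  ultimately show False using finite_imageD by blast
qed

section \<open>Polynomials in a linear operator\<close>

text \<open>This is p(A) v. The explicit sum is used because the operators of interest are linear
  only on \<open>rep_space V\<close>, not on the whole type, so evaluation in a ring of
  endomorphisms is not at hand.\<close>

definition poly_op :: "complex poly \<Rightarrow> ('a \<Rightarrow> 'a) \<Rightarrow> 'a \<Rightarrow> 'a::complex_vector" where
  "poly_op p A v = (\<Sum>k\<le>degree p. coeff p k *\<^sub>C (A ^^ k) v)"

lemma poly_op_bound:
  assumes "\<And>k. n < k \<Longrightarrow> coeff p k = 0"
  shows "poly_op p A v = (\<Sum>k\<le>n. coeff p k *\<^sub>C (A ^^ k) v)"
proof -
  have "degree p \<le> n" using assms by (rule degree_le[OF allI, OF impI])
  then show ?thesis
    unfolding poly_op_def by (intro sum.mono_neutral_left) (auto simp: coeff_eq_0)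
qed

lemma poly_op_add: "poly_op (p + q) A v = poly_op p A v + poly_op q A v"
proof -
  define n where "n = max (degree p) (degree q)"
  have "\<And>k. n < k \<Longrightarrow> coeff p k = 0" "\<And>k. n < k \<Longrightarrow> coeff q k = 0"
    by (auto simp: n_def coeff_eq_0)
  then show ?thesis
    by (simp add: poly_op_bound[of n] scaleC_add_left sum.distrib)
qed

lemma poly_op_smult: "poly_op (smult c p) A v = c *\<^sub>C poly_op p A v"
  by (simp add: poly_op_bound[of "degree p" "smult c p"] poly_op_def coeff_eq_0
      complex_vector.scale_sum_right)

lemma poly_op_monom: "poly_op (monom c n) A v = c *\<^sub>C (A ^^ n) v"
proof -
  have "poly_op (monom c n) A v = (\<Sum>k\<le>n. coeff (monom c n) k *\<^sub>C (A ^^ k) v)"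
    by (intro poly_op_bound) auto
  also have "\<dots> = (\<Sum>k\<le>n. if k = n then c *\<^sub>C (A ^^ n) v else 0)"
    by (intro sum.cong) auto
  finally have "poly_op (monom c n) A v = (\<Sum>k\<le>n. if k = n then c *\<^sub>C (A ^^ n) v else 0)" .
  then show ?thesis by simp
qed

text \<open>Placing the additional factor \<open>A\<close> innermost makes multiplication by X a
  mere shift of iterates, valid for an arbitrary map \<open>A\<close>.\<close>

lemma poly_op_pCons_0: "poly_op (pCons 0 p) A v = poly_op p A (A v)"
proof -
  have "poly_op (pCons 0 p) A v = (\<Sum>k\<le>Suc (degree p). coeff (pCons 0 p) k *\<^sub>C (A ^^ k) v)"
    by (intro poly_op_bound) (auto simp: coeff_pCons coeff_eq_0 split: nat.split)
  also have "\<dots> = (\<Sum>k\<le>degree p. coeff p k *\<^sub>C (A ^^ Suc k) v)"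
    by (simp add: sum.atMost_Suc_shift del: sum.atMost_Suc)
  finally show ?thesis by (simp add: poly_op_def funpow_swap1)
qed

lemma ex_poly_op_of_span:
  assumes "w \<in> complex_vector.span ((\<lambda>k. (A ^^ k) v) ` {..<n})"
  shows "\<exists>p. poly_op p A v = w \<and> (\<forall>k\<ge>n. coeff p k = 0)"
  using assms
proof (induction n arbitrary: w)
  case 0
  then show ?case by (intro exI[of _ 0]) (simp add: poly_op_def)
next
  case (Suc n)
  then obtain c where "w - c *\<^sub>C (A ^^ n) v \<in> complex_vector.span ((\<lambda>k. (A ^^ k) v) ` {..<n})"
    by (auto simp: lessThan_Suc complex_vector.span_breakdown_eq)
  then obtain p where "poly_op p A v = w - c *\<^sub>C (A ^^ n) v" "\<forall>k\<ge>n. coeff p k = 0"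
    using Suc.IH by blast
  then show ?case
    by (intro exI[of _ "p + monom c n"]) (auto simp: poly_op_add poly_op_monom)
qed

lemma ex_annihilating_poly:
  assumes "finite B" "\<And>n. (A ^^ n) v \<in> complex_vector.span B"
  shows "\<exists>p. p \<noteq> 0 \<and> poly_op p A v = 0"
proof -
  obtain n where "(A ^^ n) v \<in> complex_vector.span ((\<lambda>k. (A ^^ k) v) ` {..<n})"
    using ex_in_span_of_earlier[of B "\<lambda>k. (A ^^ k) v"] assms by blast
  then obtain p where p: "poly_op p A v = (A ^^ n) v" "\<forall>k\<ge>n. coeff p k = 0"
    using ex_poly_op_of_span by blast
  \<comment> \<open>The bound on the coefficients of \<open>p\<close> leaves position
    \<open>n\<close> empty, so p - X^n has coefficient -1 there and cannot vanish.\<close>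
  define q where "q = p + monom (- 1) n"
  have "coeff q n = - 1" using p(2) by (simp add: q_def)
  then have "q \<noteq> 0" by auto
  moreover have "poly_op q A v = 0" by (simp add: q_def poly_op_add poly_op_monom p(1))
  ultimately show ?thesis by blast
qed


section \<open>Weight decomposition\<close>

lemma S1_cis: "cis \<theta> \<in> S1"
  by (simp add: S1_def)

lemma S1E:
  assumes "t \<in> S1"
  obtains \<theta> where "t = cis \<theta>"
proof -
  have "t \<noteq> 0" "cmod t = 1" using assms by (auto simp: S1_def)
  then have "t = cis (Arg t)" by (simp add: cis_Arg sgn_eq)
  then show thesis by (rule that)
qed

lemma cis_powi: "cis \<theta> powi m = exp (of_real \<theta> * (\<i> * of_int m))"
proof -
  have "cis \<theta> powi m = cis (of_int m * \<theta>)" by (rule Complex.cis_power_int)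
  then show ?thesis by (simp add: cis_conv_exp mult_ac)
qed

lemma bit_cases: "p = 0 \<or> p = 1" for p :: bit
  by (cases p) auto

section \<open>The axioms of a representation, expressed through C, Z and the circle action\<close>

locale s11_module =
  fixes V :: "'v::complex_vector s11_rep"
  assumes rep: "s11_representation V"
begin

abbreviation (input) "S \<equiv> rep_space V"
abbreviation (input) "P \<equiv> rep_part V"
abbreviation (input) "\<pi> \<equiv> rep_grp V"
abbreviation (input) "A \<equiv> rep_alg V (\<i> *\<^sub>C gen_C)"

lemma subspace_S: "complex_vector.subspace S"
  and subspace_P: "complex_vector.subspace (P p)"
  and S_eq: "S = {x + y | x y. x \<in> P 0 \<and> y \<in> P 1}"
  and P_Int: "P 0 \<inter> P 1 = {0}"
  using rep by (auto simp: s11_representation_def super_space_def)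

lemma P_subset: "P p \<subseteq> S"
  using bit_cases[of p] complex_vector.subspace_0[OF subspace_P[of 0]]
    complex_vector.subspace_0[OF subspace_P[of 1]]
  by (auto simp: S_eq) (metis add.right_neutral, metis add.left_neutral)

lemma P_memD: "v \<in> P p \<Longrightarrow> v \<in> S"
  using P_subset by blast

lemma grp_linear: "t \<in> S1 \<Longrightarrow> linear_on S (\<pi> t)"
  and grp_P: "t \<in> S1 \<Longrightarrow> v \<in> P p \<Longrightarrow> \<pi> t v \<in> P p"
  and grp_1: "v \<in> S \<Longrightarrow> \<pi> 1 v = v"
  and grp_mult: "s \<in> S1 \<Longrightarrow> t \<in> S1 \<Longrightarrow> v \<in> S \<Longrightarrow> \<pi> (s * t) v = \<pi> s (\<pi> t v)"
  using rep by (auto simp: s11_representation_def S1_rep_def)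

text \<open>Invariance is assumed for the homogeneous parts, so a general vector is first split into
  an even and an odd component.\<close>

lemma grp_S: "t \<in> S1 \<Longrightarrow> v \<in> S \<Longrightarrow> \<pi> t v \<in> S"
proof -
  assume t: "t \<in> S1" and "v \<in> S"
  then obtain x y where v: "v = x + y" "x \<in> P 0" "y \<in> P 1" using S_eq by auto
  then have "\<pi> t v = \<pi> t x + \<pi> t y" using linear_on_add[OF grp_linear[OF t]] P_memD by blast
  then show "\<pi> t v \<in> S" using v t grp_P S_eq by blast
qed

lemma alg_linear: "linear_on S (rep_alg V X)"
  using rep unfolding s11_representation_def g11_rep_def by blast

lemma alg_eq:
  assumes "v \<in> S"
  shows "rep_alg V X v = fst X *\<^sub>C rep_alg V gen_C v + snd X *\<^sub>C rep_alg V gen_Z v"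
proof -
  have lin: "linear_on UNIV (\<lambda>X. rep_alg V X v)"
    using rep assms by (auto simp: s11_representation_def g11_rep_def)
  have "X = fst X *\<^sub>C gen_C + snd X *\<^sub>C gen_Z"
    by (simp add: gen_C_def gen_Z_def scaleC_prod_def scaleC_complex_def prod_eq_iff)
  then have "rep_alg V X v = rep_alg V (fst X *\<^sub>C gen_C + snd X *\<^sub>C gen_Z) v" by simp
  also have "\<dots> = fst X *\<^sub>C rep_alg V gen_C v + snd X *\<^sub>C rep_alg V gen_Z v"
    using linear_on_add[OF lin] linear_on_scale[OF lin] by simp
  finally show ?thesis .
qed

lemma A_eq: "v \<in> S \<Longrightarrow> A v = \<i> *\<^sub>C rep_alg V gen_C v"
  by (subst alg_eq) (simp_all add: gen_C_def scaleC_prod_def scaleC_complex_def)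

lemma C_eq: "v \<in> S \<Longrightarrow> rep_alg V gen_C v = (- \<i>) *\<^sub>C A v"
  by (simp add: A_eq scaleC_scaleC scaleC_one)

text \<open>Z itself is not in the real form, and the parity and bracket axioms speak only of
  elements of the real form. The multiple by 1 + i is, so facts about Z are proved for this multiple
  and then rescaled.\<close>

definition "bZ = (1 + \<i>) *\<^sub>C gen_Z"

lemma bZ_eq: "v \<in> S \<Longrightarrow> rep_alg V bZ v = (1 + \<i>) *\<^sub>C rep_alg V gen_Z v"
  by (subst alg_eq) (simp_all add: bZ_def gen_Z_def scaleC_prod_def scaleC_complex_def)

lemma Z_eq: "v \<in> S \<Longrightarrow> rep_alg V gen_Z v = inverse (1 + \<i>) *\<^sub>C rep_alg V bZ v"
proof -
  have "1 + \<i> \<noteq> 0" by (simp add: complex_eq_iff)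
  then show "v \<in> S \<Longrightarrow> rep_alg V gen_Z v = inverse (1 + \<i>) *\<^sub>C rep_alg V bZ v"
    by (simp add: bZ_eq scaleC_scaleC scaleC_one)
qed

lemma iC_real: "\<i> *\<^sub>C gen_C \<in> g11_real \<inter> g11_part 0"
  unfolding g11_real_def
  by (auto simp: g11_part_def gen_C_def gen_Z_def scaleC_prod_def scaleC_complex_def
      intro!: exI[of _ 1] exI[of _ 0])

lemma bZ_real: "bZ \<in> g11_real \<inter> g11_part 1"
  unfolding g11_real_def
  by (auto simp: g11_part_def gen_C_def gen_Z_def scaleC_prod_def scaleC_complex_def bZ_def
      intro!: exI[of _ 1] exI[of _ 0])

lemma alg_P: "X \<in> g11_real \<inter> g11_part p \<Longrightarrow> v \<in> P q \<Longrightarrow> rep_alg V X v \<in> P (p + q)"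
  using rep unfolding s11_representation_def g11_rep_def by blast

lemma A_P: "v \<in> P p \<Longrightarrow> A v \<in> P p"
  using alg_P[OF iC_real, of v p] by (simp only: add_0)

lemma C_P: "v \<in> P p \<Longrightarrow> rep_alg V gen_C v \<in> P p"
  unfolding C_eq[OF P_memD] by (intro complex_vector.subspace_scale[OF subspace_P] A_P)

lemma Z_P: "v \<in> P p \<Longrightarrow> rep_alg V gen_Z v \<in> P (1 + p)"
  unfolding Z_eq[OF P_memD] by (intro complex_vector.subspace_scale[OF subspace_P] alg_P[OF bZ_real])

lemma alg_S: "v \<in> S \<Longrightarrow> rep_alg V X v \<in> S"
proof -
  assume "v \<in> S"
  then obtain x y where v: "v = x + y" "x \<in> P 0" "y \<in> P 1" using S_eq by auto
  have "rep_alg V X u \<in> S" if "u \<in> P p" for u p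
    using C_P[OF that] Z_P[OF that] that
    by (auto simp: alg_eq[OF P_memD[OF that], of X]
        intro!: complex_vector.subspace_add[OF subspace_S] complex_vector.subspace_scale[OF subspace_S]
        dest: P_memD)
  then show ?thesis
    using v linear_on_add[OF alg_linear, of x y] complex_vector.subspace_add[OF subspace_S] P_memD
    by metis
qed

text \<open>On two odd elements the super bracket acts as XY + YX, so [Z,Z] = -2C reads 2 Z^2 = -2
  C. The computation is made with \<open>bZ\<close>, and the nonzero factor 2 (1 + i)^2 is cancelled
  at the end.\<close>

lemma ZZ:
  assumes v: "v \<in> S"
  shows "rep_alg V gen_Z (rep_alg V gen_Z v) = - rep_alg V gen_C v"
proof -
  let ?Z = "rep_alg V gen_Z"
  have b: "1 + \<i> \<noteq> 0" by (simp add: complex_eq_iff)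
  have two: "x - (- 1) *\<^sub>C x = 2 *\<^sub>C x" for x :: 'v
    using scaleC_add_left[of 1 1 x] by (simp add: scaleC_one)
  have sq: "rep_alg V bZ (rep_alg V bZ v) = ((1 + \<i>)\<^sup>2) *\<^sub>C ?Z (?Z v)"
    using v linear_on_scale[OF alg_linear alg_S[OF v]]
    by (simp add: bZ_eq alg_S complex_vector.subspace_scale[OF subspace_S] scaleC_scaleC power2_eq_square)
  have "rep_alg V (g11_bracket bZ bZ) v =
      rep_alg V bZ (rep_alg V bZ v) - (- 1) *\<^sub>C rep_alg V bZ (rep_alg V bZ v)"
    using rep v bZ_real unfolding s11_representation_def g11_rep_def by fastforce
  also have "\<dots> = 2 *\<^sub>C ((1 + \<i>)\<^sup>2) *\<^sub>C ?Z (?Z v)"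
    unfolding sq two ..
  also have "g11_bracket bZ bZ = (- 2 * (1 + \<i>)\<^sup>2) *\<^sub>C gen_C"
    by (simp add: g11_bracket_def bZ_def gen_Z_def gen_C_def scaleC_prod_def scaleC_complex_def power2_eq_square algebra_simps)
  also have "rep_alg V \<dots> v = (- 2 * (1 + \<i>)\<^sup>2) *\<^sub>C rep_alg V gen_C v"
    by (subst alg_eq[OF v]) (simp add: gen_C_def scaleC_prod_def scaleC_complex_def)
  finally have "(2 * (1 + \<i>)\<^sup>2) *\<^sub>C ?Z (?Z v) = (2 * (1 + \<i>)\<^sup>2) *\<^sub>C (- rep_alg V gen_C v)"
    by (simp add: scaleC_scaleC)
  then show ?thesis using b by (subst (asm) complex_vector.scale_cancel_left) simp
qed

lemma Z_grp:
  assumes t: "t \<in> S1" and v: "v \<in> S"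
  shows "\<pi> t (rep_alg V gen_Z v) = rep_alg V gen_Z (\<pi> t v)"
proof -
  have "t \<noteq> 0" using t by (auto simp: S1_def)
  then have t': "inverse t * t = 1" by simp
  have "inverse t \<in> S1" using t by (simp add: S1_def norm_inverse)
  then have "\<pi> (inverse t) (\<pi> t v) = v" using grp_mult[of "inverse t" t v] t v t' grp_1 by simp
  \<comment> \<open>The conjugation axiom is taken at the vector \<open>\<pi> t v\<close>, where its
    inverse group element undoes \<open>t\<close>.\<close>
  moreover have "rep_alg V bZ (\<pi> t v) = \<pi> t (rep_alg V bZ (\<pi> (inverse t) (\<pi> t v)))"
    using rep t v grp_S bZ_real unfolding s11_representation_def by blast
  ultimately have "rep_alg V bZ (\<pi> t v) = \<pi> t (rep_alg V bZ v)" by simp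
  then show ?thesis
    using linear_on_scale[OF grp_linear[OF t] alg_S[OF v]] by (simp add: Z_eq v grp_S t)
qed

section \<open>Matrix coefficients and local finiteness of orbits\<close>

lemma coefficient_deriv:
  assumes v: "v \<in> S" and \<phi>: "linear_on UNIV (\<phi> :: 'v \<Rightarrow> complex)"
  shows "((\<lambda>\<theta>. \<phi> (\<pi> (cis \<theta>) v)) has_vector_derivative \<phi> (\<pi> (cis \<theta>\<^sub>0) (A v))) (at \<theta>\<^sub>0)"
proof -
  let ?\<psi> = "\<lambda>u. \<phi> (\<pi> (cis \<theta>\<^sub>0) u)"
  \<comment> \<open>The derivative is assumed at 0 only. Composing \<open>\<phi>\<close> with
    \<open>\<pi> (cis \<theta>\<^sub>0)\<close> transports it to \<open>\<theta>\<^sub>0\<close> by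
    the group law. The composite is known to be linear only on the representation space, which is
    what \<open>is_differential\<close> asks of a functional.\<close>
  have "linear_on S ?\<psi>"
    using \<phi> grp_linear[OF S1_cis[of \<theta>\<^sub>0]] by (auto simp: linear_on_def)
  then have "((\<lambda>\<theta>. ?\<psi> (\<pi> (cis \<theta>) v)) has_vector_derivative ?\<psi> (A v)) (at 0)"
    using rep v unfolding s11_representation_def is_differential_def by blast
  then have "((\<lambda>\<theta>. \<phi> (\<pi> (cis (\<theta>\<^sub>0 + \<theta>)) v)) has_vector_derivative ?\<psi> (A v)) (at 0)"
    by (simp add: grp_mult[OF S1_cis S1_cis v] flip: cis_mult)
  then have "(((\<lambda>\<theta>. \<phi> (\<pi> (cis (\<theta>\<^sub>0 + \<theta>)) v)) \<circ> (\<lambda>\<theta>. \<theta> - \<theta>\<^sub>0)) has_vector_derivative 1 *\<^sub>R ?\<psi> (A v)) (at \<theta>\<^sub>0)"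
    by (intro vector_diff_chain_at) (auto intro!: derivative_eq_intros simp: has_vector_derivative_diff_const)
  then show ?thesis by (simp add: o_def)
qed

text \<open>A linearly independent sequence of orbit points converging to \<open>v\<close> would admit a functional
  that is unbounded along it.\<close>

lemma orbit_locally_finite_dim:
  assumes v: "v \<in> S"
  shows "\<exists>\<delta>>0. \<exists>B. finite B \<and> (\<forall>\<theta>. \<bar>\<theta>\<bar> < \<delta> \<longrightarrow> \<pi> (cis \<theta>) v \<in> complex_vector.span B)"
proof (rule ccontr)
  let ?q = "\<lambda>\<theta>. \<pi> (cis \<theta>) v"
  assume contra: "\<not> ?thesis"
  \<comment> \<open>The negated claim gives an orbit point outside any finitely generated space, at
    an angle below any prescribed bound. It is used with bound 1/(n+1) and with the points already
    chosen as generators.\<close>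
  have "\<exists>\<theta>. \<forall>n. \<bar>\<theta> n\<bar> < inverse (real (Suc n)) \<and> ?q (\<theta> n) \<notin> complex_vector.span ((?q \<circ> \<theta>) ` {..<n})"
  proof (rule dependent_wellorder_choice)
    fix r and f g :: "nat \<Rightarrow> real" and n assume "\<And>k. k < n \<Longrightarrow> f k = g k"
    then have "(?q \<circ> f) ` {..<n} = (?q \<circ> g) ` {..<n}" by auto
    then show "(\<bar>r\<bar> < inverse (real (Suc n)) \<and> ?q r \<notin> complex_vector.span ((?q \<circ> f) ` {..<n})) =
      (\<bar>r\<bar> < inverse (real (Suc n)) \<and> ?q r \<notin> complex_vector.span ((?q \<circ> g) ` {..<n}))" by simp
  next
    fix n and f :: "nat \<Rightarrow> real"
    have "inverse (real (Suc n)) > 0" "finite ((?q \<circ> f) ` {..<n})" by auto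
    then show "\<exists>r. \<bar>r\<bar> < inverse (real (Suc n)) \<and> ?q r \<notin> complex_vector.span ((?q \<circ> f) ` {..<n})"
      using contra by blast
  qed
  then obtain \<theta> where \<theta>: "\<And>n. \<bar>\<theta> n\<bar> < inverse (real (Suc n))"
    and new: "\<And>n. (?q \<circ> \<theta>) n \<notin> complex_vector.span ((?q \<circ> \<theta>) ` {..<n})"
    by auto
  note ind = independent_sequence[of "?q \<circ> \<theta>", OF new]
  obtain \<phi> :: "'v \<Rightarrow> complex" where \<phi>: "linear_on UNIV \<phi>"
    and val: "\<forall>b\<in>range (?q \<circ> \<theta>). \<phi> b = of_nat (inv (?q \<circ> \<theta>) b)"
    using ex_functional_on_independent[OF ind(2), of "\<lambda>b. of_nat (inv (?q \<circ> \<theta>) b)"] by blast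
  have val: "\<phi> (?q (\<theta> n)) = of_nat n" for n
    using val inv_f_f[OF ind(1), of n] by auto
  have "\<theta> \<longlonglongrightarrow> 0"
    by (rule Lim_null_comparison[OF _ LIMSEQ_inverse_real_of_nat])
      (use \<theta> in \<open>auto intro!: always_eventually less_imp_le\<close>)
  moreover have "isCont (\<lambda>\<theta>. \<phi> (?q \<theta>)) 0"
    using coefficient_deriv[OF v \<phi>] by (rule has_vector_derivative_continuous)
  ultimately have "(\<lambda>n. \<phi> (?q (\<theta> n))) \<longlonglongrightarrow> \<phi> (?q 0)"
    by (rule isCont_tendsto_compose[rotated])
  then have "Bseq (\<lambda>n. of_nat n :: complex)"
    unfolding val by (intro convergent_imp_Bseq convergentI)
  then obtain K where "\<And>n. real n \<le> K" by (auto simp: Bseq_def)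
  then show False using reals_Archimedean2[of K] by (meson not_le)
qed

lemma funpow_A_S: "v \<in> S \<Longrightarrow> (A ^^ n) v \<in> S"
  by (induction n) (auto intro: alg_S)

text \<open>A functional that kills the span but takes the value 1 on the derivative would give a
  coefficient that vanishes near \<open>\<theta>\<close> and yet has derivative 1 there. This
  replaces closedness of finite-dimensional subspaces.\<close>

lemma derivative_in_span:
  assumes u: "u \<in> S" and B: "\<And>\<theta>. \<bar>\<theta>\<bar> < \<delta> \<Longrightarrow> \<pi> (cis \<theta>) u \<in> complex_vector.span B" and \<theta>: "\<bar>\<theta>\<bar> < \<delta>"
  shows "\<pi> (cis \<theta>) (A u) \<in> complex_vector.span B"
proof (rule ccontr)
  assume "\<pi> (cis \<theta>) (A u) \<notin> complex_vector.span B"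
  then obtain \<phi> :: "'v \<Rightarrow> complex" where \<phi>: "linear_on UNIV \<phi>" "\<phi> (\<pi> (cis \<theta>) (A u)) = 1"
    "\<forall>y\<in>complex_vector.span B. \<phi> y = 0"
    using ex_functional_separating by blast
  have "((\<lambda>\<theta>. \<phi> (\<pi> (cis \<theta>) u)) has_vector_derivative 1) (at \<theta>)"
    using coefficient_deriv[OF u \<phi>(1), of \<theta>] \<phi>(2) by simp
  moreover have "\<theta> \<in> {- \<delta><..<\<delta>}" using \<theta> by auto
  ultimately have "((\<lambda>_. 0 :: complex) has_vector_derivative 1) (at \<theta>)"
    by (rule has_vector_derivative_transform_within_open[OF _ open_greaterThanLessThan])
      (use \<phi>(3) B in auto)
  then show False
    using vector_derivative_unique_at[OF _ has_vector_derivative_const] by fastforce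
qed

lemma ex_A_annihilating_poly:
  assumes v: "v \<in> S"
  shows "\<exists>p. p \<noteq> 0 \<and> poly_op p A v = 0"
proof -
  obtain \<delta> B where \<delta>: "\<delta> > 0" "finite B" "\<And>\<theta>. \<bar>\<theta>\<bar> < \<delta> \<Longrightarrow> \<pi> (cis \<theta>) v \<in> complex_vector.span B"
    using orbit_locally_finite_dim[OF v] by blast
  \<comment> \<open>The induction runs over the whole interval of angles and not just at 0, since
    each differentiation needs the previous statement on a neighbourhood.\<close>
  have "\<pi> (cis \<theta>) ((A ^^ n) v) \<in> complex_vector.span B" if "\<bar>\<theta>\<bar> < \<delta>" for \<theta> n
    using that
  proof (induction n arbitrary: \<theta>)
    case (Suc n)
    then show ?case using derivative_in_span[OF funpow_A_S[OF v, of n], of \<delta> B] by simp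
  qed (use \<delta> in simp)
  from this[of 0] have "(A ^^ n) v \<in> complex_vector.span B" for n
    using \<delta>(1) grp_1[OF funpow_A_S[OF v]] by simp
  then show ?thesis using ex_annihilating_poly \<delta>(2) by blast
qed

section \<open>Orbits of eigenvectors and of Jordan blocks\<close>

lemma coefficient_affine:
  assumes w: "w \<in> S" and \<phi>: "linear_on UNIV (\<phi> :: 'v \<Rightarrow> complex)"
    and eq: "A w = a *\<^sub>C w + u" and u: "\<And>\<theta>. \<pi> (cis \<theta>) u = exp (a * of_real \<theta>) *\<^sub>C u"
    and uS: "u \<in> S"
  shows "\<phi> (\<pi> (cis \<theta>) w) = exp (a * of_real \<theta>) * (\<phi> w + of_real \<theta> * \<phi> u)"
proof -
  \<comment> \<open>The coefficient f solves f' = a f + exp(a \<theta>) \<phi>(u). By variation of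
    constants exp(-a \<theta>) f should be affine with slope \<phi>(u), so subtracting the linear
    term leaves a constant.\<close>
  define g where "g = (\<lambda>\<theta>. exp (- (a * of_real \<theta>)) * \<phi> (\<pi> (cis \<theta>) w) - of_real \<theta> * \<phi> u)"
  have "(g has_vector_derivative 0) (at \<theta>)" for \<theta>
  proof -
    let ?E = "exp (- (a * of_real \<theta>))"
    have "\<pi> (cis \<theta>) (A w) = a *\<^sub>C \<pi> (cis \<theta>) w + exp (a * of_real \<theta>) *\<^sub>C u"
      using linear_on_add[OF grp_linear[OF S1_cis[of \<theta>]], of "a *\<^sub>C w" u] w uS
        linear_on_scale[OF grp_linear[OF S1_cis[of \<theta>]] w]
        complex_vector.subspace_scale[OF subspace_S w] by (simp add: eq u)
    then have D: "\<phi> (\<pi> (cis \<theta>) (A w)) = a * \<phi> (\<pi> (cis \<theta>) w) + exp (a * of_real \<theta>) * \<phi> u"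
      using linear_on_add[OF \<phi>] linear_on_scale[OF \<phi>] by (simp add: scaleC_complex_def)
    have D': "((\<lambda>\<theta>. exp (- (a * of_real \<theta>))) has_vector_derivative - a * ?E) (at \<theta>)"
      by (auto intro!: derivative_eq_intros has_vector_derivative_real_field simp: algebra_simps)
    have EE: "?E * exp (a * of_real \<theta>) = 1" by (simp add: exp_minus)
    have cancel: "E * (a * x + e * y) + - a * E * x = E * e * y" for E e x y :: complex
      by (simp add: algebra_simps)
    from has_vector_derivative_mult[OF D' coefficient_deriv[OF w \<phi>, of \<theta>]]
    have "((\<lambda>\<theta>. exp (- (a * of_real \<theta>)) * \<phi> (\<pi> (cis \<theta>) w)) has_vector_derivative \<phi> u) (at \<theta>)"
      by (rule has_vector_derivative_eq_rhs) (simp only: D cancel EE mult_1)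
    moreover have "((\<lambda>\<theta>. of_real \<theta> * \<phi> u) has_vector_derivative \<phi> u) (at \<theta>)"
      by (auto intro!: derivative_eq_intros has_vector_derivative_real_field)
    ultimately have "(g has_vector_derivative \<phi> u - \<phi> u) (at \<theta>)"
      unfolding g_def by (rule has_vector_derivative_diff)
    then show ?thesis by simp
  qed
  then have "g \<theta> = g 0"
    by (intro has_derivative_zero_unique[OF convex_UNIV]) (auto simp: has_vector_derivative_def)
  then show ?thesis
    by (simp add: g_def grp_1[OF w] exp_minus field_simps)
qed

text \<open>The case u = 0 of \<open>coefficient_affine\<close>, read through all functionals. The
  result then supplies the assumption on \<open>u\<close> when that lemma is applied to a block of
  length two.\<close>

lemma grp_eigenvector:
  assumes w: "w \<in> S" and eq: "A w = a *\<^sub>C w"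
  shows "\<pi> (cis \<theta>) w = exp (a * of_real \<theta>) *\<^sub>C w"
proof (rule functionals_separate)
  fix \<phi> :: "'v \<Rightarrow> complex" assume \<phi>: "linear_on UNIV \<phi>"
  have "\<pi> (cis \<theta>) 0 = 0" for \<theta>
    using linear_on_zero[OF grp_linear[OF S1_cis] subspace_S] .
  then show "\<phi> (\<pi> (cis \<theta>) w) = \<phi> (exp (a * of_real \<theta>) *\<^sub>C w)"
    using coefficient_affine[OF w \<phi>, of a 0 \<theta>] eq linear_on_scale[OF \<phi>]
      linear_on_zero[OF \<phi>] complex_vector.subspace_0[OF subspace_S]
    by (simp add: scaleC_complex_def)
qed

text \<open>A full turn is the identity of the circle, yet it scales an eigenvector by this
  exponential.\<close>

lemma eigenvalue_exp:
  assumes w: "w \<in> S" "w \<noteq> 0" and eq: "A w = a *\<^sub>C w"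
  shows "exp (a * of_real (2 * pi)) = 1"
proof -
  have "exp (a * of_real (2 * pi)) *\<^sub>C w = 1 *\<^sub>C w"
    using grp_eigenvector[OF w(1) eq, of "2 * pi"] grp_1[OF w(1)] by (simp add: scaleC_one)
  with w(2) show ?thesis by (simp only: complex_vector.scale_cancel_right) simp
qed

text \<open>A nontrivial Jordan block would make a matrix coefficient grow linearly, against periodicity.\<close>

lemma no_jordan_block:
  assumes w: "w \<in> S" and u: "u \<in> S" and eq: "A w = a *\<^sub>C w + u" "A u = a *\<^sub>C u"
  shows "u = 0"
proof (rule ccontr)
  assume "u \<noteq> 0"
  with eigenvalue_exp[OF u _ eq(2)] have e: "exp (a * of_real (2 * pi)) = 1" by simp
  have "u = 0"
  proof (rule functionals_separate)
    fix \<phi> :: "'v \<Rightarrow> complex" assume \<phi>: "linear_on UNIV \<phi>"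
    have "\<phi> (\<pi> (cis (2 * pi)) w) = \<phi> w + of_real (2 * pi) * \<phi> u"
      using coefficient_affine[OF w \<phi> eq(1) grp_eigenvector[OF u eq(2)] u, of "2 * pi"] e by simp
    then show "\<phi> u = \<phi> 0" using grp_1[OF w] linear_on_zero[OF \<phi>] by simp
  qed
  with \<open>u \<noteq> 0\<close> show False ..
qed

text \<open>For w nonzero, exp(2 pi a) = 1 forces a = i n with n an integer, and then exp(a
  \<theta>) is the n-th power of \<open>cis \<theta>\<close>. The zero vector lies in every weight
  space.\<close>

lemma eigenvector_weight_space:
  assumes w: "w \<in> S" and eq: "A w = a *\<^sub>C w"
  shows "\<exists>m. w \<in> weight_space V m"
proof (cases "w = 0")
  case True
  then show ?thesis
    using w linear_on_zero[OF grp_linear subspace_S] by (auto simp: weight_space_def)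
next
  case False
  from eigenvalue_exp[OF w False eq] obtain n :: int where
    "Re (a * of_real (2 * pi)) = 0" "Im (a * of_real (2 * pi)) = of_int (2 * n) * pi"
    unfolding exp_eq_1 by blast
  then have a: "a = \<i> * of_int n" by (simp add: complex_eq_iff)
  have "\<pi> t w = (t powi n) *\<^sub>C w" if "t \<in> S1" for t
  proof -
    obtain \<theta> where t: "t = cis \<theta>" using S1E[OF \<open>t \<in> S1\<close>] .
    have "exp (a * of_real \<theta>) = cis \<theta> powi n"
      by (simp add: a cis_powi mult_ac)
    then show ?thesis using grp_eigenvector[OF w eq, of \<theta>] t by simp
  qed
  then show ?thesis using w by (auto simp: weight_space_def)
qed

section \<open>Diagonalizability of the infinitesimal action\<close>

definition "eigenspace a = {w \<in> S. A w = a *\<^sub>C w}"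

lemma subspace_eigenspace: "complex_vector.subspace (eigenspace a)"
  using complex_vector.subspace_0[OF subspace_S] complex_vector.subspace_add[OF subspace_S]
    complex_vector.subspace_scale[OF subspace_S]
  by (intro complex_vector.subspaceI)
    (auto simp: eigenspace_def linear_on_add[OF alg_linear] linear_on_scale[OF alg_linear]
      linear_on_zero[OF alg_linear subspace_S] scaleC_add_right scaleC_scaleC mult.commute)

lemma span_eigenspaces_S: "complex_vector.span (\<Union>b\<in>T. eigenspace b) \<subseteq> S"
  by (intro complex_vector.span_minimal subspace_S) (auto simp: eigenspace_def)

text \<open>On the eigenspace of b the operator A - a is multiplication by b - a, which is
  invertible for b different from a. The image of the span is a subspace containing each of these
  eigenspaces, hence everything.\<close>

lemma A_shift_onto:
  assumes "z \<in> complex_vector.span (\<Union>b\<in>-{a}. eigenspace b)"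
  shows "\<exists>z'\<in>complex_vector.span (\<Union>b\<in>-{a}. eigenspace b). A z' - a *\<^sub>C z' = z"
proof -
  let ?E = "complex_vector.span (\<Union>b\<in>-{a}. eigenspace b)"
  have sub: "x \<in> S" if "x \<in> ?E" for x using that span_eigenspaces_S by blast
  have "?E \<subseteq> (\<lambda>z. A z - a *\<^sub>C z) ` ?E"
  proof (rule complex_vector.span_minimal)
    show "(\<Union>b\<in>-{a}. eigenspace b) \<subseteq> (\<lambda>z. A z - a *\<^sub>C z) ` ?E"
    proof
      fix w assume "w \<in> (\<Union>b\<in>-{a}. eigenspace b)"
      then obtain b where b: "b \<noteq> a" "w \<in> eigenspace b" by auto
      let ?z = "inverse (b - a) *\<^sub>C w"
      have "A ?z - a *\<^sub>C ?z = inverse (b - a) *\<^sub>C (b - a) *\<^sub>C w"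
        using b(2) by (simp add: eigenspace_def linear_on_scale[OF alg_linear] scaleC_scaleC
            complex_vector.scale_left_diff_distrib complex_vector.scale_right_diff_distrib mult.commute)
      also have "\<dots> = w" using b(1) by (simp add: scaleC_scaleC scaleC_one)
      finally have "w = A ?z - a *\<^sub>C ?z" by simp
      moreover have "?z \<in> ?E"
        using b by (intro complex_vector.span_scale complex_vector.span_base) auto
      ultimately show "w \<in> (\<lambda>z. A z - a *\<^sub>C z) ` ?E" by (rule image_eqI)
    qed
    show "complex_vector.subspace ((\<lambda>z. A z - a *\<^sub>C z) ` ?E)"
    proof (rule complex_vector.subspaceI)
      show "0 \<in> (\<lambda>z. A z - a *\<^sub>C z) ` ?E"
        by (rule image_eqI[of _ _ 0])
          (auto simp: linear_on_zero[OF alg_linear subspace_S] complex_vector.span_zero)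
    next
      fix x y assume "x \<in> (\<lambda>z. A z - a *\<^sub>C z) ` ?E" "y \<in> (\<lambda>z. A z - a *\<^sub>C z) ` ?E"
      then obtain x' y' where xy: "x' \<in> ?E" "y' \<in> ?E" "x = A x' - a *\<^sub>C x'" "y = A y' - a *\<^sub>C y'"
        by auto
      have "x + y = A (x' + y') - a *\<^sub>C (x' + y')"
        using linear_on_add[OF alg_linear sub sub, OF xy(1,2)] xy by (simp add: scaleC_add_right)
      then show "x + y \<in> (\<lambda>z. A z - a *\<^sub>C z) ` ?E"
        using complex_vector.span_add[OF xy(1,2)] by blast
    next
      fix c x assume "x \<in> (\<lambda>z. A z - a *\<^sub>C z) ` ?E"
      then obtain x' where x: "x' \<in> ?E" "x = A x' - a *\<^sub>C x'" by auto
      have "c *\<^sub>C x = A (c *\<^sub>C x') - a *\<^sub>C (c *\<^sub>C x')"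
        using linear_on_scale[OF alg_linear sub, OF x(1)] x
        by (simp add: scaleC_scaleC mult.commute complex_vector.scale_right_diff_distrib)
      then show "c *\<^sub>C x \<in> (\<lambda>z. A z - a *\<^sub>C z) ` ?E"
        using complex_vector.span_scale[OF x(1)] by blast
    qed
  qed
  with assms show ?thesis by (auto simp: image_iff subset_iff)
qed

text \<open>Write (A - a) v = w + z with \<open>w\<close> in the eigenspace of \<open>a\<close> and
  \<open>z\<close> in the span of the others. Surjectivity of A - a on that span gives z = (A - a)
  z', so v - z' sits above \<open>w\<close> in a Jordan block. Hence w = 0, and v - z' is an
  eigenvector.\<close>

lemma span_eigenspaces_shift:
  assumes v: "v \<in> S" and y: "A v - a *\<^sub>C v \<in> complex_vector.span (\<Union>b. eigenspace b)"
  shows "v \<in> complex_vector.span (\<Union>b. eigenspace b)"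
proof -
  let ?E = "\<Union>b\<in>-{a}. eigenspace b"
  have U: "(\<Union>b. eigenspace b) = eigenspace a \<union> ?E" by auto
  obtain w z where wz: "w \<in> eigenspace a" "z \<in> complex_vector.span ?E" "A v - a *\<^sub>C v = w + z"
    using y unfolding U complex_vector.span_Un complex_vector.span_eq_iff[THEN iffD2, OF subspace_eigenspace]
    by auto
  obtain z' where z': "z' \<in> complex_vector.span ?E" "A z' - a *\<^sub>C z' = z"
    using A_shift_onto[OF wz(2)] by blast
  have z'S: "z' \<in> S" using z'(1) span_eigenspaces_S by blast
  have vz: "v - z' \<in> S" using complex_vector.subspace_diff[OF subspace_S v z'S] .
  have eq: "A (v - z') = a *\<^sub>C (v - z') + w"
    using linear_on_diff[OF alg_linear subspace_S v z'S, of "\<i> *\<^sub>C gen_C"] wz(3) z'(2)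
    by (simp add: complex_vector.scale_right_diff_distrib algebra_simps)
  have "w = 0" using no_jordan_block[OF vz _ eq] wz(1) by (simp add: eigenspace_def)
  then have "v - z' \<in> eigenspace a" using eq vz by (simp add: eigenspace_def)
  then have "v - z' \<in> complex_vector.span (\<Union>b. eigenspace b)" by (intro complex_vector.span_base) auto
  moreover have "z' \<in> complex_vector.span (\<Union>b. eigenspace b)"
    using z'(1) complex_vector.span_mono[of ?E "\<Union>b. eigenspace b"] by auto
  ultimately show ?thesis using complex_vector.span_add by fastforce
qed

lemma poly_op_diff_arg:
  assumes "x \<in> S" "y \<in> S"
  shows "poly_op p A (x - c *\<^sub>C y) = poly_op p A x - c *\<^sub>C poly_op p A y"
proof -
  have "(A ^^ k) (x - c *\<^sub>C y) = (A ^^ k) x - c *\<^sub>C (A ^^ k) y" for k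
    using assms
    by (induction k) (auto simp: funpow_A_S linear_on_diff[OF alg_linear subspace_S]
        complex_vector.subspace_scale[OF subspace_S] linear_on_scale[OF alg_linear])
  then show ?thesis
    by (simp add: poly_op_def sum_subtractf complex_vector.scale_right_diff_distrib
        complex_vector.scale_sum_right scaleC_scaleC mult.commute)
qed

text \<open>Induction on the degree of an annihilating polynomial, with the vector left free. A root
  \<open>a\<close> splits p as (X - a) q, so \<open>q\<close> annihilates (A - a) v, and the
  preceding lemma passes from (A - a) v back to \<open>v\<close>. In degree 0 a nonzero constant
  kills \<open>v\<close>, so v = 0.\<close>

lemma span_eigenspaces:
  assumes "v \<in> S"
  shows "v \<in> complex_vector.span (\<Union>b. eigenspace b)"
proof -
  have "v \<in> complex_vector.span (\<Union>b. eigenspace b)"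
    if "p \<noteq> 0" "poly_op p A v = 0" "v \<in> S" for p v
    using that
  proof (induction "degree p" arbitrary: p v)
    case 0
    then obtain c where "p = [:c:]" "c \<noteq> 0" by (metis degree_eq_zeroE pCons_0_0)
    with 0 have "v = 0" by (simp add: poly_op_def)
    then show ?case by (simp add: complex_vector.span_zero)
  next
    case (Suc n)
    then have "\<not> constant (poly p)" by (simp add: constant_degree)
    then obtain a where "poly p a = 0" using fundamental_theorem_of_algebra by blast
    then obtain q where q: "p = [:- a, 1:] * q" by (auto simp: poly_eq_0_iff_dvd elim: dvdE)
    have "q \<noteq> 0" using Suc.prems q by auto
    then have deg: "degree q = n" using Suc.hyps(2) using degree_mult_eq[of "[:- a, 1:]" q] q by simp
    \<comment> \<open>The product (X - a) q is written as X q - a q so that the rules for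
      \<open>poly_op\<close> apply term by term.\<close>
    have p: "p = pCons 0 q + smult (- a) q" by (simp add: q)
    have "poly_op q A (A v - a *\<^sub>C v) = poly_op p A v"
      unfolding p poly_op_add poly_op_pCons_0 poly_op_smult
      using Suc.prems by (simp add: poly_op_diff_arg alg_S)
    then have "poly_op q A (A v - a *\<^sub>C v) = 0" using Suc.prems by simp
    moreover have "A v - a *\<^sub>C v \<in> S"
      using Suc.prems by (intro complex_vector.subspace_diff[OF subspace_S]
          complex_vector.subspace_scale[OF subspace_S] alg_S)
    ultimately have "A v - a *\<^sub>C v \<in> complex_vector.span (\<Union>b. eigenspace b)"
      using Suc.hyps(1)[of q] deg \<open>q \<noteq> 0\<close> by blast
    then show ?case using span_eigenspaces_shift Suc.prems by blast
  qed
  then show ?thesis using ex_A_annihilating_poly[OF assms] assms by blast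
qed

lemma span_weight_spaces: "v \<in> S \<Longrightarrow> v \<in> complex_vector.span (\<Union>m. weight_space V m)"
proof -
  have "(\<Union>b. eigenspace b) \<subseteq> (\<Union>m. weight_space V m)"
    using eigenvector_weight_space by (auto simp: eigenspace_def)
  then show "v \<in> S \<Longrightarrow> ?thesis" using span_eigenspaces complex_vector.span_mono by blast
qed

section \<open>Weight spaces, parity and the odd operator\<close>

lemma weight_space_C:
  assumes v: "v \<in> weight_space V m"
  shows "rep_alg V gen_C v = of_int m *\<^sub>C v"
proof -
  have vS: "v \<in> S" using v by (simp add: weight_space_def)
  \<comment> \<open>The same coefficient is differentiated at 0 twice: once by the representation
    axioms, once as an explicit exponential.\<close>
  have "A v = (\<i> * of_int m) *\<^sub>C v"
  proof (rule functionals_separate)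
    fix \<phi> :: "'v \<Rightarrow> complex" assume \<phi>: "linear_on UNIV \<phi>"
    have "\<phi> (\<pi> (cis \<theta>) v) = exp (of_real \<theta> * (\<i> * of_int m)) * \<phi> v" for \<theta>
    proof -
      have "\<pi> (cis \<theta>) v = (cis \<theta> powi m) *\<^sub>C v"
        using v S1_cis by (auto simp: weight_space_def)
      also have "cis \<theta> powi m = exp (of_real \<theta> * (\<i> * of_int m))"
        by (rule cis_powi)
      finally show ?thesis using linear_on_scale[OF \<phi>] by (simp add: scaleC_complex_def)
    qed
    then have "((\<lambda>\<theta>. exp (of_real \<theta> * (\<i> * of_int m)) * \<phi> v) has_vector_derivative \<phi> (A v)) (at 0)"
      using coefficient_deriv[OF vS \<phi>, of 0] grp_1[OF alg_S[OF vS]] by simp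
    moreover have "((\<lambda>\<theta>. exp (of_real \<theta> * (\<i> * of_int m)) * \<phi> v) has_vector_derivative
        (\<i> * of_int m) * \<phi> v) (at 0)"
      by (auto intro!: derivative_eq_intros has_vector_derivative_real_field)
    ultimately have "\<phi> (A v) = (\<i> * of_int m) * \<phi> v" by (rule vector_derivative_unique_at)
    then show "\<phi> (A v) = \<phi> ((\<i> * of_int m) *\<^sub>C v)"
      using linear_on_scale[OF \<phi>, of v "\<i> * of_int m"] by (simp add: scaleC_complex_def)
  qed
  then show ?thesis using C_eq[OF vS] by (simp add: scaleC_scaleC)
qed

lemma weight_space_ZZ:
  assumes "v \<in> weight_space V m"
  shows "rep_alg V gen_Z (rep_alg V gen_Z v) = (- of_int m) *\<^sub>C v"
  using ZZ[of v] weight_space_C[OF assms] assms by (simp add: weight_space_def)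

lemma weight_space_Z:
  assumes v: "v \<in> weight_space V m"
  shows "rep_alg V gen_Z v \<in> weight_space V m"
  using v by (auto simp: weight_space_def alg_S Z_grp linear_on_scale[OF alg_linear])

lemma subspace_weight_space: "complex_vector.subspace (weight_space V m)"
  using complex_vector.subspace_0[OF subspace_S] complex_vector.subspace_add[OF subspace_S]
    complex_vector.subspace_scale[OF subspace_S]
  by (intro complex_vector.subspaceI)
    (auto simp: weight_space_def linear_on_add[OF grp_linear] linear_on_scale[OF grp_linear]
      linear_on_zero[OF grp_linear subspace_S] scaleC_add_right scaleC_scaleC mult.commute)

lemma decomposition_unique:
  assumes "x \<in> P 0" "y \<in> P 1" "x' \<in> P 0" "y' \<in> P 1" "x + y = x' + y'"
  shows "x = x'" "y = y'"
proof -
  have "x - x' = (x + y) - y - x'" by simp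
  then have eq: "x - x' = y' - y" unfolding assms(5) by simp
  have "x - x' \<in> P 0" using assms by (intro complex_vector.subspace_diff[OF subspace_P])
  moreover have "x - x' \<in> P 1" unfolding eq using assms by (intro complex_vector.subspace_diff[OF subspace_P])
  ultimately have "x - x' = 0" using P_Int by blast
  then show "x = x'" "y = y'" using assms(5) by auto
qed

text \<open>The circle preserves parity, so the components of \<open>\<pi> t v\<close> are the
  images of the components of \<open>v\<close>, and uniqueness of the decomposition gives the weight
  condition on each.\<close>

lemma weight_space_graded:
  assumes v: "v \<in> weight_space V m"
  obtains x y where "v = x + y" "x \<in> P 0 \<inter> weight_space V m" "y \<in> P 1 \<inter> weight_space V m"
proof -
  have "v \<in> S" using v by (simp add: weight_space_def)
  then obtain x y where xy: "v = x + y" "x \<in> P 0" "y \<in> P 1" using S_eq by auto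
  have "\<pi> t x = (t powi m) *\<^sub>C x \<and> \<pi> t y = (t powi m) *\<^sub>C y" if t: "t \<in> S1" for t
  proof -
    have "\<pi> t x + \<pi> t y = \<pi> t v"
      using linear_on_add[OF grp_linear[OF t], of x y] xy P_memD by metis
    also have "\<dots> = (t powi m) *\<^sub>C x + (t powi m) *\<^sub>C y"
      using v t by (simp add: weight_space_def xy scaleC_add_right)
    finally show ?thesis
      using decomposition_unique[OF grp_P[OF t xy(2)] grp_P[OF t xy(3)]] xy
        complex_vector.subspace_scale[OF subspace_P] by blast
  qed
  then show thesis using that[OF xy(1)] xy P_memD by (auto simp: weight_space_def)
qed

text \<open>Homogeneous weight vectors span the whole space. A vector of parity \<open>p\<close> is
  thus a sum of an even and an odd combination of them, and uniqueness of the decomposition removes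
  the combination of the wrong parity.\<close>

lemma P_eq_span:
  "P p = complex_vector.span (\<Union>m. P p \<inter> weight_space V m)"
proof
  let ?E = "\<lambda>p. \<Union>m. P p \<inter> weight_space V m"
  have E: "complex_vector.span (?E p) \<subseteq> P p" for p
    by (intro complex_vector.span_minimal subspace_P) auto
  then show "complex_vector.span (?E p) \<subseteq> P p" .
  have "(\<Union>m. weight_space V m) \<subseteq> complex_vector.span (?E 0 \<union> ?E 1)"
  proof
    fix v assume "v \<in> (\<Union>m. weight_space V m)"
    then obtain m where "v \<in> weight_space V m" by auto
    then obtain x y where "v = x + y" "x \<in> P 0 \<inter> weight_space V m" "y \<in> P 1 \<inter> weight_space V m"
      by (rule weight_space_graded)
    then show "v \<in> complex_vector.span (?E 0 \<union> ?E 1)"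
      by (auto intro!: complex_vector.span_add intro: complex_vector.span_base)
  qed
  then have sp: "S \<subseteq> complex_vector.span (?E 0 \<union> ?E 1)"
    using span_weight_spaces complex_vector.span_minimal complex_vector.subspace_span by blast
  show "P p \<subseteq> complex_vector.span (?E p)"
  proof
    fix v assume v: "v \<in> P p"
    then obtain x y where xy: "v = x + y" "x \<in> complex_vector.span (?E 0)" "y \<in> complex_vector.span (?E 1)"
      using sp P_memD[OF v] unfolding complex_vector.span_Un by blast
    then have xy': "x \<in> P 0" "y \<in> P 1" using E by blast+
    have z: "0 \<in> P q" for q using complex_vector.subspace_0[OF subspace_P] .
    from bit_cases[of p] show "v \<in> complex_vector.span (?E p)"
    proof
      assume p: "p = 0"
      have "x = v"
        by (rule decomposition_unique(1)[OF xy']) (use v z p in \<open>auto simp flip: xy(1)\<close>)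
      with xy(2) p show ?thesis by simp
    next
      assume p: "p = 1"
      have "y = v"
        by (rule decomposition_unique(2)[OF xy']) (use v z p in \<open>auto simp flip: xy(1)\<close>)
      with xy(3) p show ?thesis by simp
    qed
  qed
qed

end
section \<open>Standard super weight spaces\<close>

definition weight_root :: "int \<Rightarrow> complex" where
  "weight_root m = csqrt (- of_int m)"

lemma weight_root_square: "(weight_root m)\<^sup>2 = - of_int m"
  by (simp add: weight_root_def)

definition weight_model :: "int \<Rightarrow> (complex \<times> complex) s11_rep" where
  "weight_model m = \<lparr>
     rep_space = UNIV,
     rep_part = (\<lambda>p. if p = 0 then {x. snd x = 0} else {x. fst x = 0}),
     rep_grp = (\<lambda>t x. (t powi m) *\<^sub>C x),
     rep_alg = (\<lambda>X x. (fst X * of_int m * fst x + snd X * weight_root m * snd x,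
                        fst X * of_int m * snd x + snd X * weight_root m * fst x))\<rparr>"

lemma dim_span_singleton:
  assumes "v \<noteq> (0 :: 'a::complex_vector)"
  shows "complex_vector.dim (complex_vector.span {v}) = 1"
  using complex_vector.dim_eq_card_independent[of "{v}"] assms
  by (simp add: complex_vector.independent_insert complex_vector.independent_empty)

lemma has_vector_derivative_cis_powi:
  "((\<lambda>\<theta>. cis \<theta> powi m * c) has_vector_derivative \<i> * of_int m * c) (at 0)"
  unfolding cis_powi by (auto intro!: derivative_eq_intros has_vector_derivative_real_field)

lemma weight_model_representation: "s11_representation (weight_model m)"
proof -
  note defs = weight_model_def scaleC_prod_def scaleC_complex_def
  have "super_space (rep_space (weight_model m)) (rep_part (weight_model m))"
  proof -
    have "x \<in> {a + b | a b. snd a = 0 \<and> fst b = 0}" for x :: "complex \<times> complex"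
      by (rule CollectI, rule exI[of _ "(fst x, 0)"], rule exI[of _ "(0, snd x)"]) (simp add: prod_eq_iff)
    then show ?thesis
      by (auto simp: super_space_def complex_vector.subspace_def defs prod_eq_iff)
  qed
  moreover have "S1_rep (weight_model m)"
    by (auto simp: S1_rep_def linear_on_def defs power_int_mult_distrib algebra_simps)
  moreover have "g11_rep (weight_model m)"
  proof -
    have lin: "linear_on UNIV (rep_alg (weight_model m) X)"
      "linear_on UNIV (\<lambda>X. rep_alg (weight_model m) X v)" for X v
      by (auto simp: linear_on_def defs algebra_simps)
    \<comment> \<open>Parity and bracket are checked for all complex homogeneous elements; the
      axioms on the real form are special cases.\<close>
    have part: "rep_alg (weight_model m) X v \<in> rep_part (weight_model m) (p + q)"
      if "X \<in> g11_part p" "v \<in> rep_part (weight_model m) q" for p q X v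
      using bit_cases[of p] bit_cases[of q] that by (auto simp: defs g11_part_def)
    have rr: "weight_root m * weight_root m = - of_int m"
      using weight_root_square[of m] by (simp add: power2_eq_square)
    have "rep_alg (weight_model m) (g11_bracket X Y) v =
          rep_alg (weight_model m) X (rep_alg (weight_model m) Y v)
            - (if p = 1 \<and> q = 1 then - 1 else 1) *\<^sub>C
              rep_alg (weight_model m) Y (rep_alg (weight_model m) X v)"
      if "X \<in> g11_part p" "Y \<in> g11_part q" for p q X Y v
      using bit_cases[of p] bit_cases[of q] that
      by (auto simp: defs g11_part_def g11_bracket_def algebra_simps rr)
    with lin part show ?thesis
      unfolding g11_rep_def by (auto simp: weight_model_def)
  qed
  moreover have "is_differential (weight_model m)"
    unfolding is_differential_def
  proof (intro ballI allI impI)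
    fix v :: "complex \<times> complex" and \<phi> :: "complex \<times> complex \<Rightarrow> complex"
    assume "linear_on (rep_space (weight_model m)) \<phi>"
    then have \<phi>: "\<phi> (c *\<^sub>C v) = c * \<phi> v" for c v
      using linear_on_scale[of UNIV \<phi> v c] by (simp add: weight_model_def scaleC_complex_def)
    have "rep_alg (weight_model m) (\<i> *\<^sub>C gen_C) v = (\<i> * of_int m) *\<^sub>C v"
      by (simp add: defs gen_C_def)
    then show "((\<lambda>\<theta>. \<phi> (rep_grp (weight_model m) (cis \<theta>) v)) has_vector_derivative
        \<phi> (rep_alg (weight_model m) (\<i> *\<^sub>C gen_C) v)) (at 0)"
      using has_vector_derivative_cis_powi[of m "\<phi> v"] by (simp add: \<phi>) (simp add: weight_model_def \<phi>)
  qed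
  moreover have "rep_alg (weight_model m) X v =
      rep_grp (weight_model m) t (rep_alg (weight_model m) X (rep_grp (weight_model m) (inverse t) v))"
    if "t \<in> S1" for t X v
  proof -
    have "t \<noteq> 0" using that by (auto simp: S1_def)
    then have "t powi m * inverse t powi m = 1"
      by (simp add: power_int_inverse)
    then show ?thesis by (simp add: defs algebra_simps)
  qed
  ultimately show ?thesis unfolding s11_representation_def by blast
qed

lemma super_weight_space_model:
  assumes "m \<noteq> 0"
  shows "super_weight_space m (weight_model m)"
proof -
  have span: "rep_part (weight_model m) 0 = complex_vector.span {(1, 0)}"
    "rep_part (weight_model m) 1 = complex_vector.span {(0, 1)}"
    by (auto simp: weight_model_def complex_vector.span_singleton scaleC_prod_def scaleC_complex_def)
  have "complex_vector.dim (rep_part (weight_model m) 0) = 1"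
    "complex_vector.dim (rep_part (weight_model m) 1) = 1"
    unfolding span by (rule dim_span_singleton; simp add: zero_prod_def)+
  moreover have "\<exists>v0 v1 r. r\<^sup>2 = - of_int m \<and>
        rep_part (weight_model m) 0 = complex_vector.span {v0} \<and>
        rep_part (weight_model m) 1 = complex_vector.span {v1} \<and>
        rep_alg (weight_model m) gen_Z v0 = r *\<^sub>C v1 \<and> rep_alg (weight_model m) gen_Z v1 = r *\<^sub>C v0"
    using span weight_root_square[of m]
    by (intro exI[of _ "(1, 0)"] exI[of _ "(0, 1)"] exI[of _ "weight_root m"])
      (simp add: weight_model_def gen_Z_def scaleC_prod_def scaleC_complex_def)
  ultimately show ?thesis
    using assms weight_model_representation[of m]
    by (simp add: super_weight_space_def)
      (simp add: weight_model_def gen_C_def scaleC_prod_def scaleC_complex_def)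
qed

section \<open>Internal direct sums\<close>

text \<open>Embeddings of the summands add up to a map \<open>g\<close> from the direct sum to
  \<open>V\<close>, which is finite at each argument since supports are finite. The work is done on
  \<open>g\<close>, and its inverse is the required map. Injectivity is asked as a trivial kernel
  and surjectivity separately in each parity, since the isomorphism must match the parts.\<close>

lemma (in s11_module) s11_iso_direct_sumI:
  fixes W :: "'i \<Rightarrow> 'w::complex_vector s11_rep" and e :: "'i \<Rightarrow> 'w \<Rightarrow> 'v"
  assumes W: "\<And>i. i \<in> I \<Longrightarrow> s11_representation (W i)"
    and lin: "\<And>i. i \<in> I \<Longrightarrow> linear_on (rep_space (W i)) (e i)"
    and part: "\<And>i p x. i \<in> I \<Longrightarrow> x \<in> rep_part (W i) p \<Longrightarrow> e i x \<in> P p"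
    and grp: "\<And>i t x. i \<in> I \<Longrightarrow> t \<in> S1 \<Longrightarrow> x \<in> rep_space (W i) \<Longrightarrow> e i (rep_grp (W i) t x) = \<pi> t (e i x)"
    and alg: "\<And>i X x. i \<in> I \<Longrightarrow> x \<in> rep_space (W i) \<Longrightarrow> e i (rep_alg (W i) X x) = rep_alg V X (e i x)"
    and inj: "\<And>h. h \<in> rep_space (direct_sum I W) \<Longrightarrow> (\<Sum>i | h i \<noteq> 0. e i (h i)) = 0 \<Longrightarrow> h = 0"
    and surj: "\<And>p. P p \<subseteq> complex_vector.span (\<Union>i\<in>I. e i ` rep_part (W i) p)"
  shows "s11_iso V (direct_sum I W)"
proof -
  define D where "D = direct_sum I W"
  define g where "g h = (\<Sum>i | h i \<noteq> 0. e i (h i))" for h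
  have WM: "s11_module (W i)" if "i \<in> I" for i using W[OF that] by unfold_locales
  note sub_W = s11_module.subspace_S[OF WM]
  have e0: "e i 0 = 0" if "i \<in> I" for i using linear_on_zero[OF lin sub_W] that by blast
  have D_iff: "h \<in> rep_space D \<longleftrightarrow>
      finite {i. h i \<noteq> 0} \<and> (\<forall>i\<in>I. h i \<in> rep_space (W i)) \<and> (\<forall>i. i \<notin> I \<longrightarrow> h i = 0)" for h
    by (simp add: D_def direct_sum_def)
  have DP_iff: "h \<in> rep_part D p \<longleftrightarrow>
      finite {i. h i \<noteq> 0} \<and> (\<forall>i\<in>I. h i \<in> rep_part (W i) p) \<and> (\<forall>i. i \<notin> I \<longrightarrow> h i = 0)" for h p
    by (simp add: D_def direct_sum_def)
  have supp: "{i. h i \<noteq> 0} \<subseteq> I" if "h \<in> rep_space D" for h using that by (auto simp: D_iff)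
  have DP_sub: "rep_part D p \<subseteq> rep_space D" for p
    using s11_module.P_subset[OF WM] unfolding D_iff DP_iff subset_iff by blast
  have supp_add: "{i. (h + k) i \<noteq> 0} \<subseteq> {i. h i \<noteq> 0} \<union> {i. k i \<noteq> 0}" for h k :: "'i \<Rightarrow> 'w" by auto
  have supp_scale: "{i. (c *\<^sub>C h) i \<noteq> 0} \<subseteq> {i. h i \<noteq> 0}" for c and h :: "'i \<Rightarrow> 'w"
    by (auto simp: scaleC_fun_def)
  have D_subspace: "complex_vector.subspace (rep_space D)"
  proof (rule complex_vector.subspaceI)
    show "0 \<in> rep_space D" by (simp add: D_iff complex_vector.subspace_0[OF sub_W])
    show "h + k \<in> rep_space D" if "h \<in> rep_space D" "k \<in> rep_space D" for h k
      using that finite_subset[OF supp_add, of h k] complex_vector.subspace_add[OF sub_W]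
      unfolding D_iff by auto
    show "c *\<^sub>C h \<in> rep_space D" if "h \<in> rep_space D" for c h
      using that finite_subset[OF supp_scale, of h c] complex_vector.subspace_scale[OF sub_W]
      unfolding D_iff by (auto simp: scaleC_fun_def)
  qed
  note sub_WP = s11_module.subspace_P[OF WM]
  have DP_subspace: "complex_vector.subspace (rep_part D p)" for p
  proof (rule complex_vector.subspaceI)
    show "0 \<in> rep_part D p" by (simp add: DP_iff complex_vector.subspace_0[OF sub_WP])
    show "h + k \<in> rep_part D p" if "h \<in> rep_part D p" "k \<in> rep_part D p" for h k
      using that finite_subset[OF supp_add, of h k] complex_vector.subspace_add[OF sub_WP]
      unfolding DP_iff by auto
    show "c *\<^sub>C h \<in> rep_part D p" if "h \<in> rep_part D p" for c h
      using that finite_subset[OF supp_scale, of h c] complex_vector.subspace_scale[OF sub_WP]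
      unfolding DP_iff by (auto simp: scaleC_fun_def)
  qed
  have eS: "e i x \<in> S" if i: "i \<in> I" and x: "x \<in> rep_space (W i)" for i x
  proof -
    obtain y z where yz: "x = y + z" "y \<in> rep_part (W i) 0" "z \<in> rep_part (W i) 1"
      using x unfolding s11_module.S_eq[OF WM[OF i]] by blast
    then have "e i x = e i y + e i z"
      using linear_on_add[OF lin[OF i]] s11_module.P_memD[OF WM[OF i]] by blast
    then show ?thesis
      using part[OF i yz(2)] part[OF i yz(3)] by (auto simp: S_eq)
  qed
  \<comment> \<open>The sum defining \<open>g\<close> ranges over a support that varies with its
    argument. A common finite index set makes sums for different arguments comparable.\<close>
  have g_eq: "g h = (\<Sum>i\<in>T. e i (h i))" if "finite T" "T \<subseteq> I" "{i. h i \<noteq> 0} \<subseteq> T" for h T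
    unfolding g_def using that e0 by (intro sum.mono_neutral_left) auto
  have g_lin: "linear_on (rep_space D) g"
    unfolding linear_on_def
  proof (intro conjI ballI allI)
    fix h k assume h: "h \<in> rep_space D" and k: "k \<in> rep_space D"
    define T where "T = {i. h i \<noteq> 0} \<union> {i. k i \<noteq> 0}"
    have T: "finite T" "T \<subseteq> I" using h k supp unfolding T_def by (auto simp: D_iff)
    have "g (h + k) = (\<Sum>i\<in>T. e i ((h + k) i))" by (rule g_eq[OF T]) (auto simp: T_def)
    also have "\<dots> = (\<Sum>i\<in>T. e i (h i) + e i (k i))"
      using T(2) h k by (intro sum.cong) (auto simp: D_iff intro!: linear_on_add[OF lin])
    also have "\<dots> = g h + g k"
      using g_eq[OF T, of h] g_eq[OF T, of k] by (auto simp: sum.distrib T_def)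
    finally show "g (h + k) = g h + g k" .
  next
    fix c h assume h: "h \<in> rep_space D"
    have T: "finite {i. h i \<noteq> 0}" "{i. h i \<noteq> 0} \<subseteq> I" using h supp by (auto simp: D_iff)
    have "g (c *\<^sub>C h) = (\<Sum>i | h i \<noteq> 0. e i ((c *\<^sub>C h) i))" by (rule g_eq[OF T supp_scale])
    also have "\<dots> = (\<Sum>i | h i \<noteq> 0. c *\<^sub>C e i (h i))"
      using T(2) h by (intro sum.cong) (auto simp: D_iff scaleC_fun_def intro!: linear_on_scale[OF lin])
    also have "\<dots> = c *\<^sub>C g h" by (simp add: g_def complex_vector.scale_sum_right)
    finally show "g (c *\<^sub>C h) = c *\<^sub>C g h" .
  qed
  have grp_D: "rep_grp D t h \<in> rep_space D \<and> g (rep_grp D t h) = \<pi> t (g h)"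
    if t: "t \<in> S1" and h: "h \<in> rep_space D" for t h
  proof -
    have T: "finite {i. h i \<noteq> 0}" "{i. h i \<noteq> 0} \<subseteq> I" using h supp by (auto simp: D_iff)
    have eq: "rep_grp D t h i = (if i \<in> I then rep_grp (W i) t (h i) else 0)" for i
      by (simp add: D_def direct_sum_def)
    have s: "{i. rep_grp D t h i \<noteq> 0} \<subseteq> {i. h i \<noteq> 0}"
      using linear_on_zero[OF s11_module.grp_linear[OF WM t] sub_W] by (auto simp: eq)
    have "rep_grp D t h \<in> rep_space D"
      using h finite_subset[OF s T(1)] s11_module.grp_S[OF WM t] unfolding D_iff by (auto simp: eq)
    moreover have "g (rep_grp D t h) = (\<Sum>i | h i \<noteq> 0. e i (rep_grp D t h i))" by (rule g_eq[OF T s])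
    moreover have "\<dots> = (\<Sum>i | h i \<noteq> 0. \<pi> t (e i (h i)))"
      using T(2) h t by (intro sum.cong) (auto simp: D_iff eq grp)
    moreover have "\<dots> = \<pi> t (g h)"
      unfolding g_def using T(2) h
      by (intro linear_on_sum[OF grp_linear[OF t] subspace_S, symmetric]) (auto simp: D_iff intro!: eS)
    ultimately show ?thesis by simp
  qed
  have alg_D: "rep_alg D X h \<in> rep_space D \<and> g (rep_alg D X h) = rep_alg V X (g h)"
    if h: "h \<in> rep_space D" for X h
  proof -
    have T: "finite {i. h i \<noteq> 0}" "{i. h i \<noteq> 0} \<subseteq> I" using h supp by (auto simp: D_iff)
    have eq: "rep_alg D X h i = (if i \<in> I then rep_alg (W i) X (h i) else 0)" for i
      by (simp add: D_def direct_sum_def)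
    have s: "{i. rep_alg D X h i \<noteq> 0} \<subseteq> {i. h i \<noteq> 0}"
      using linear_on_zero[OF s11_module.alg_linear[OF WM] sub_W, of _ X] by (auto simp: eq)
    have "rep_alg D X h \<in> rep_space D"
      using h finite_subset[OF s T(1)] s11_module.alg_S[OF WM] unfolding D_iff by (auto simp: eq)
    moreover have "g (rep_alg D X h) = (\<Sum>i | h i \<noteq> 0. e i (rep_alg D X h i))" by (rule g_eq[OF T s])
    moreover have "\<dots> = (\<Sum>i | h i \<noteq> 0. rep_alg V X (e i (h i)))"
      using T(2) h by (intro sum.cong) (auto simp: D_iff eq alg)
    moreover have "\<dots> = rep_alg V X (g h)"
      unfolding g_def using T(2) h
      by (intro linear_on_sum[OF alg_linear subspace_S, symmetric]) (auto simp: D_iff intro!: eS)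
    ultimately show ?thesis by simp
  qed
  have gP: "g ` rep_part D p = P p" for p
  proof
    show "g ` rep_part D p \<subseteq> P p"
    proof clarify
      fix h assume h: "h \<in> rep_part D p"
      then have "{i. h i \<noteq> 0} \<subseteq> I" using DP_sub supp by blast
      then show "g h \<in> P p"
        unfolding g_def using h
        by (intro complex_vector.subspace_sum[OF subspace_P] part) (auto simp: DP_iff)
    qed
    have "complex_vector.subspace (g ` rep_part D p)"
    proof (rule complex_vector.subspaceI)
      show "0 \<in> g ` rep_part D p"
        using complex_vector.subspace_0[OF DP_subspace, of p] linear_on_zero[OF g_lin D_subspace]
        by (metis image_eqI)
      show "x + y \<in> g ` rep_part D p" if xy: "x \<in> g ` rep_part D p" "y \<in> g ` rep_part D p" for x y
      proof -
        obtain h k where hk: "x = g h" "y = g k" "h \<in> rep_part D p" "k \<in> rep_part D p" using xy by blast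
        then have "x + y = g (h + k)"
          using linear_on_add[OF g_lin subsetD[OF DP_sub hk(3)] subsetD[OF DP_sub hk(4)]] by simp
        then show ?thesis using complex_vector.subspace_add[OF DP_subspace hk(3,4)] by blast
      qed
      show "c *\<^sub>C x \<in> g ` rep_part D p" if x: "x \<in> g ` rep_part D p" for c x
      proof -
        obtain h where h: "x = g h" "h \<in> rep_part D p" using x by blast
        then have "c *\<^sub>C x = g (c *\<^sub>C h)" using linear_on_scale[OF g_lin, of h c] DP_sub[of p] by auto
        then show ?thesis using complex_vector.subspace_scale[OF DP_subspace h(2)] by blast
      qed
    qed
    moreover have "(\<Union>i\<in>I. e i ` rep_part (W i) p) \<subseteq> g ` rep_part D p"
    proof clarify
      fix i x assume i: "i \<in> I" and x: "x \<in> rep_part (W i) p"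
      \<comment> \<open>The family concentrated at \<open>i\<close> is the preimage of
        \<open>e i x\<close>.\<close>
      let ?h = "\<lambda>j. if j = i then x else 0"
      have s: "{j. ?h j \<noteq> 0} \<subseteq> {i}" by auto
      have "?h \<in> rep_part D p"
        using i x finite_subset[OF s] complex_vector.subspace_0[OF sub_WP] unfolding DP_iff by auto
      moreover have "g ?h = e i x" using g_eq[OF _ _ s] i by simp
      ultimately show "e i x \<in> g ` rep_part D p" by (metis image_eqI)
    qed
    ultimately show "P p \<subseteq> g ` rep_part D p"
      using surj[of p] complex_vector.span_minimal by blast
  qed
  have inj_g: "inj_on g (rep_space D)"
  proof (rule inj_onI)
    fix h k assume h: "h \<in> rep_space D" and k: "k \<in> rep_space D" and "g h = g k"
    then have "g (h - k) = 0" using linear_on_diff[OF g_lin D_subspace h k] by simp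
    then have "h - k = 0"
      using inj[of "h - k"] complex_vector.subspace_diff[OF D_subspace h k] by (simp add: g_def D_def)
    then show "h = k" by simp
  qed
  have gS: "g ` rep_space D = S"
  proof
    show "g ` rep_space D \<subseteq> S"
    proof clarify
      fix h assume h: "h \<in> rep_space D"
      then have "{i. h i \<noteq> 0} \<subseteq> I" using supp by blast
      then show "g h \<in> S"
        unfolding g_def using h
        by (intro complex_vector.subspace_sum[OF subspace_S] eS) (auto simp: D_iff)
    qed
    show "S \<subseteq> g ` rep_space D"
    proof
      fix v assume "v \<in> S"
      then obtain x y where "v = x + y" "x \<in> P 0" "y \<in> P 1" using S_eq by auto
      then obtain h k where hk: "v = g h + g k" "h \<in> rep_part D 0" "k \<in> rep_part D 1"
        unfolding gP[symmetric] by auto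
      then have mem: "h \<in> rep_space D" "k \<in> rep_space D" using DP_sub by blast+
      then have "v = g (h + k)" using hk(1) linear_on_add[OF g_lin] by simp
      then show "v \<in> g ` rep_space D" using complex_vector.subspace_add[OF D_subspace mem] by blast
    qed
  qed
  define f where "f = inv_into (rep_space D) g"
  have bij: "bij_betw g (rep_space D) S" using inj_g gS by (simp add: bij_betw_def)
  \<comment> \<open>Each property of \<open>f\<close> below reduces to the matching property of
    \<open>g\<close>: it is enough to name a member of the direct sum and compute its image.\<close>
  have f_eq: "f v = h" if "h \<in> rep_space D" "g h = v" for v h
    using that inv_into_f_f[OF inj_g] by (auto simp: f_def)
  have f_mem: "f v \<in> rep_space D" and gf: "g (f v) = v" if "v \<in> S" for v
    using that gS by (auto simp: f_def inv_into_into f_inv_into_f)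
  have "linear_on S f"
    unfolding linear_on_def
  proof (intro conjI ballI allI)
    show "f (x + y) = f x + f y" if "x \<in> S" "y \<in> S" for x y
      using that f_mem gf complex_vector.subspace_add[OF D_subspace] linear_on_add[OF g_lin]
      by (intro f_eq) auto
    show "f (c *\<^sub>C x) = c *\<^sub>C f x" if "x \<in> S" for c x
      using that f_mem gf complex_vector.subspace_scale[OF D_subspace] linear_on_scale[OF g_lin]
      by (intro f_eq) auto
  qed
  moreover have "bij_betw f S (rep_space D)" unfolding f_def by (rule bij_betw_inv_into[OF bij])
  moreover have "f ` P p = rep_part D p" for p
    unfolding gP[symmetric] f_def using inv_into_image_cancel[OF inj_g DP_sub] .
  moreover have "f (\<pi> t v) = rep_grp D t (f v)" if "t \<in> S1" "v \<in> S" for t v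
    using grp_D[OF that(1) f_mem[OF that(2)]] gf[OF that(2)] by (intro f_eq) auto
  moreover have "f (rep_alg V X v) = rep_alg D X (f v)" if "v \<in> S" for X v
    using alg_D[OF f_mem[OF that], of X] gf[OF that] by (intro f_eq) auto
  ultimately show ?thesis unfolding s11_iso_def D_def[symmetric] by blast
qed



section \<open>The theorem\<close>

lemma independent_family_zero:
  fixes b :: "'i \<Rightarrow> 'a::complex_vector"
  assumes "complex_vector.independent B" "finite T" "inj_on b T" "b ` T \<subseteq> B"
    and sum: "(\<Sum>i\<in>T. u i *\<^sub>C b i) = 0" and i: "i \<in> T"
  shows "u i = 0"
proof -
  have "(\<Sum>v\<in>b ` T. u (inv_into T b v) *\<^sub>C v) = (\<Sum>i\<in>T. u i *\<^sub>C b i)"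
    using assms(3) by (simp add: sum.reindex)
  then have "u (inv_into T b (b i)) = 0"
    using complex_vector.independentD[OF assms(1) _ assms(4), of "\<lambda>v. u (inv_into T b v)" "b i"]
      assms(2) i sum by auto
  then show ?thesis using assms(3) i by simp
qed

context s11_module
begin

text \<open>The i-th summand is embedded with even generator \<open>b i\<close> and odd generator
  \<open>c i\<close>. A vanishing sum splits by parity, and Z turns its odd half into a relation
  among the \<open>b i\<close>, so independence of the even basis settles both halves. Spanning of
  the odd part is likewise obtained from the even part through Z.\<close>

lemma s11_iso_direct_sum_of_weight_models:
  fixes b :: "'i \<Rightarrow> 'v" and \<mu> :: "'i \<Rightarrow> int"
  assumes b: "\<And>i. i \<in> I \<Longrightarrow> b i \<in> P 0 \<inter> weight_space V (\<mu> i)"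
    and \<mu>: "\<And>i. i \<in> I \<Longrightarrow> \<mu> i \<noteq> 0"
    and inj: "inj_on b I" and ind: "complex_vector.independent (b ` I)"
    and P0: "P 0 = complex_vector.span (b ` I)"
    and V0: "weight_space V 0 = {0}"
  shows "s11_iso V (direct_sum I (\<lambda>i. weight_model (\<mu> i)))"
proof -
  let ?Z = "rep_alg V gen_Z"
  define r where "r i = weight_root (\<mu> i)" for i
  \<comment> \<open>Dividing by r with r^2 = -m balances the matrix of Z: Z b = r c by definition,
    and Z c = Z^2 b / r = r b.\<close>
  define c where "c i = inverse (r i) *\<^sub>C ?Z (b i)" for i
  define e where "e i x = fst x *\<^sub>C b i + snd x *\<^sub>C c i" for i and x :: "complex \<times> complex"
  have r0: "r i \<noteq> 0" if "i \<in> I" for i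
    using weight_root_square[of "\<mu> i"] \<mu>[OF that] by (auto simp: r_def)
  have bS: "b i \<in> S" if "i \<in> I" for i using b[OF that] by (auto simp: weight_space_def)
  have cP: "c i \<in> P 1" if "i \<in> I" for i
    unfolding c_def using Z_P[of "b i" 0] b[OF that]
    by (intro complex_vector.subspace_scale[OF subspace_P]) simp
  have cW: "c i \<in> weight_space V (\<mu> i)" if "i \<in> I" for i
    unfolding c_def using b[OF that]
    by (intro complex_vector.subspace_scale[OF subspace_weight_space] weight_space_Z) simp
  have cS: "c i \<in> S" if "i \<in> I" for i using cP[OF that] by (rule P_memD)
  have Zb: "?Z (b i) = r i *\<^sub>C c i" if "i \<in> I" for i
    using r0[OF that] by (simp add: c_def scaleC_scaleC scaleC_one)
  have Zc: "?Z (c i) = r i *\<^sub>C b i" if i: "i \<in> I" for i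
  proof -
    have "?Z (c i) = inverse (r i) *\<^sub>C ?Z (?Z (b i))"
      unfolding c_def by (rule linear_on_scale[OF alg_linear alg_S[OF bS[OF i]]])
    also have "?Z (?Z (b i)) = (r i * r i) *\<^sub>C b i"
      using weight_space_ZZ[of "b i" "\<mu> i"] b[OF i] weight_root_square[of "\<mu> i"]
      by (simp add: r_def power2_eq_square)
    finally show ?thesis using r0[OF i] by (simp add: scaleC_scaleC)
  qed
  show ?thesis
  proof (rule s11_iso_direct_sumI[where e = e])
    fix i assume i: "i \<in> I"
    show "s11_representation (weight_model (\<mu> i))" by (rule weight_model_representation)
    show "linear_on (rep_space (weight_model (\<mu> i))) (e i)"
      by (auto simp: linear_on_def e_def scaleC_prod_def scaleC_complex_def scaleC_add_left
          scaleC_add_right scaleC_scaleC)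
    show "e i x \<in> P p" if "x \<in> rep_part (weight_model (\<mu> i)) p" for p x
      using bit_cases[of p]
    proof
      assume "p = 0"
      then show ?thesis using that b[OF i]
        by (simp add: weight_model_def e_def complex_vector.subspace_scale[OF subspace_P])
    next
      assume "p = 1"
      then show ?thesis using that cP[OF i]
        by (simp add: weight_model_def e_def complex_vector.subspace_scale[OF subspace_P])
    qed
    have eW: "e i x \<in> weight_space V (\<mu> i)" for x
      unfolding e_def using b[OF i] cW[OF i]
      by (intro complex_vector.subspace_add[OF subspace_weight_space]
          complex_vector.subspace_scale[OF subspace_weight_space]) auto
    show "e i (rep_grp (weight_model (\<mu> i)) t x) = \<pi> t (e i x)" if "t \<in> S1" for t x
    proof -
      have "\<pi> t (e i x) = (t powi \<mu> i) *\<^sub>C e i x" using eW[of x] that by (simp add: weight_space_def)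
      then show ?thesis
        by (simp add: weight_model_def e_def scaleC_prod_def scaleC_complex_def scaleC_add_right scaleC_scaleC)
    qed
    show "e i (rep_alg (weight_model (\<mu> i)) X x) = rep_alg V X (e i x)" for X x
    proof -
      have S: "fst x *\<^sub>C b i \<in> S" "snd x *\<^sub>C c i \<in> S"
        using bS[OF i] cS[OF i] by (auto intro: complex_vector.subspace_scale[OF subspace_S])
      have "?Z (e i x) = fst x *\<^sub>C r i *\<^sub>C c i + snd x *\<^sub>C r i *\<^sub>C b i"
        using linear_on_add[OF alg_linear S] linear_on_scale[OF alg_linear bS[OF i]]
          linear_on_scale[OF alg_linear cS[OF i]] by (simp add: e_def Zb[OF i] Zc[OF i])
      moreover have "rep_alg V X (e i x) = fst X *\<^sub>C of_int (\<mu> i) *\<^sub>C e i x + snd X *\<^sub>C ?Z (e i x)"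
        using alg_eq[of "e i x" X] weight_space_C[OF eW] eW[of x] by (simp add: weight_space_def)
      ultimately show ?thesis
        by (simp add: weight_model_def e_def r_def scaleC_add_left scaleC_add_right scaleC_scaleC
            algebra_simps)
    qed
  next
    fix h assume h: "h \<in> rep_space (direct_sum I (\<lambda>i. weight_model (\<mu> i)))"
      and 0: "(\<Sum>i | h i \<noteq> 0. e i (h i)) = 0"
    define T where "T = {i. h i \<noteq> 0}"
    have T: "finite T" "T \<subseteq> I" using h by (auto simp: T_def direct_sum_def)
    have iT: "inj_on b T" "b ` T \<subseteq> b ` I" using T(2) inj by (auto intro: inj_on_subset)
    let ?x = "\<Sum>i\<in>T. fst (h i) *\<^sub>C b i" and ?y = "\<Sum>i\<in>T. snd (h i) *\<^sub>C c i"
    have "?x \<in> P 0"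
      using T b by (intro complex_vector.subspace_sum[OF subspace_P] complex_vector.subspace_scale[OF subspace_P]) auto
    moreover have "?y \<in> P 1"
      using T cP by (intro complex_vector.subspace_sum[OF subspace_P] complex_vector.subspace_scale[OF subspace_P]) auto
    moreover have "?x + ?y = 0 + 0"
      using 0 by (simp add: T_def e_def sum.distrib)
    ultimately have xy: "?x = 0" "?y = 0"
      using decomposition_unique[of ?x ?y 0 0] complex_vector.subspace_0[OF subspace_P] by blast+
    \<comment> \<open>Applying Z moves the odd relation into the even part, where the basis is known
      to be independent.\<close>
    have "?Z ?y = (\<Sum>i\<in>T. ?Z (snd (h i) *\<^sub>C c i))"
      using T cS by (intro linear_on_sum[OF alg_linear subspace_S])
        (auto intro: complex_vector.subspace_scale[OF subspace_S])
    also have "\<dots> = (\<Sum>i\<in>T. (snd (h i) * r i) *\<^sub>C b i)"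
      using T cS by (intro sum.cong) (auto simp: linear_on_scale[OF alg_linear] Zc scaleC_scaleC)
    finally have "(\<Sum>i\<in>T. (snd (h i) * r i) *\<^sub>C b i) = 0"
      using xy(2) linear_on_zero[OF alg_linear subspace_S] by simp
    then have "snd (h i) * r i = 0" if "i \<in> T" for i
      using independent_family_zero[OF ind T(1) iT _ that, of "\<lambda>i. snd (h i) * r i"] by simp
    moreover have "fst (h i) = 0" if "i \<in> T" for i
      using independent_family_zero[OF ind T(1) iT xy(1) that] .
    ultimately have "h i = 0" if "i \<in> T" for i
      using that r0 T(2) by (auto simp: prod_eq_iff)
    then show "h = 0" by (auto simp: T_def fun_eq_iff)
  next
    fix p
    let ?U = "complex_vector.span (\<Union>i\<in>I. e i ` rep_part (weight_model (\<mu> i)) p)"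
    show "P p \<subseteq> ?U"
      using bit_cases[of p]
    proof
      assume p: "p = 0"
      have "b ` I \<subseteq> (\<Union>i\<in>I. e i ` rep_part (weight_model (\<mu> i)) p)"
      proof clarify
        fix i assume "i \<in> I"
        moreover have "b i = e i (1, 0)" by (simp add: e_def scaleC_one)
        moreover have "(1, 0) \<in> rep_part (weight_model (\<mu> i)) p" by (simp add: weight_model_def p)
        ultimately show "b i \<in> (\<Union>i\<in>I. e i ` rep_part (weight_model (\<mu> i)) p)" by blast
      qed
      then show ?thesis using P0 p complex_vector.span_mono by blast
    next
      assume p: "p = 1"
      have c: "c i \<in> ?U" if "i \<in> I" for i
      proof -
        have "c i = e i (0, 1)" by (simp add: e_def scaleC_one)
        moreover have "(0, 1) \<in> rep_part (weight_model (\<mu> i)) p" by (simp add: weight_model_def p)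
        ultimately show ?thesis using that by (intro complex_vector.span_base) blast
      qed
      have ZU: "?Z x \<in> ?U" if "x \<in> P 0" for x
      proof -
        have "complex_vector.span (b ` I) \<subseteq> {x \<in> S. ?Z x \<in> ?U}"
        proof (rule complex_vector.span_minimal)
          show "b ` I \<subseteq> {x \<in> S. ?Z x \<in> ?U}"
            using bS complex_vector.span_scale[OF c] by (auto simp: Zb)
          show "complex_vector.subspace {x \<in> S. ?Z x \<in> ?U}"
            using complex_vector.subspace_0[OF subspace_S] complex_vector.subspace_add[OF subspace_S]
              complex_vector.subspace_scale[OF subspace_S]
            by (intro complex_vector.subspaceI)
              (auto simp: linear_on_zero[OF alg_linear subspace_S] linear_on_add[OF alg_linear]
                linear_on_scale[OF alg_linear] intro: complex_vector.span_zero
                complex_vector.span_add complex_vector.span_scale)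
        qed
        with that P0 show ?thesis by blast
      qed
      have "(\<Union>m. P 1 \<inter> weight_space V m) \<subseteq> ?U"
      proof clarify
        fix m y assume y: "y \<in> P 1" "y \<in> weight_space V m"
        show "y \<in> ?U"
        proof (cases "m = 0")
          case True
          then show ?thesis using y V0 complex_vector.span_zero by auto
        next
          case False
          have "?Z y \<in> P 0" using Z_P[OF y(1)] by simp
          \<comment> \<open>Since Z^2 = -m on weight m, this multiple recovers \<open>y\<close> as Z
            applied to an even vector, up to a scalar.\<close>
          then have "(- inverse (of_int m)) *\<^sub>C ?Z (?Z y) \<in> ?U"
            by (intro complex_vector.span_scale ZU)
          also have "(- inverse (of_int m)) *\<^sub>C ?Z (?Z y) = y"
            using False by (simp add: weight_space_ZZ[OF y(2)] scaleC_scaleC scaleC_one)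
          finally show ?thesis .
        qed
      qed
      from complex_vector.span_minimal[OF this complex_vector.subspace_span]
      show ?thesis unfolding p by (subst P_eq_span)
    qed
  qed
qed

text \<open>The finite-dimensional weight spaces, indexed by the countable set of integers, make the
  even basis countable, which allows natural numbers as indices of the summands.\<close>

lemma ex_s11_iso_direct_sum:
  assumes triv: "no_trivial_S1_subrep V" and fin: "\<And>m. finite_dim (weight_space V m)"
  shows "\<exists>(I :: nat set) W. (\<forall>i\<in>I. \<exists>m. super_weight_space m (W i :: (complex \<times> complex) s11_rep)) \<and>
    s11_iso V (direct_sum I W)"
proof -
  have V0: "weight_space V 0 = {0}"
  proof -
    have "weight_space V 0 \<subseteq> S \<and> (\<forall>t\<in>S1. \<forall>u\<in>weight_space V 0. \<pi> t u = u)"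
      by (auto simp: weight_space_def scaleC_one)
    then show ?thesis using triv subspace_weight_space[of 0] unfolding no_trivial_S1_subrep_def by blast
  qed
  \<comment> \<open>The basis is chosen inside the union of the even weight spaces, so that each of
    its members is a weight vector.\<close>
  obtain B where B: "B \<subseteq> (\<Union>m. P 0 \<inter> weight_space V m)" "complex_vector.independent B"
    "(\<Union>m. P 0 \<inter> weight_space V m) \<subseteq> complex_vector.span B"
    using complex_vector.maximal_independent_subset by blast
  have P0: "P 0 = complex_vector.span B"
    using P_eq_span[of 0] B by (metis complex_vector.span_mono complex_vector.span_span subset_antisym)
  have "finite (B \<inter> weight_space V m)" for m
  proof -
    obtain F where F: "finite F" "weight_space V m \<subseteq> complex_vector.span F"
      using fin[of m] by (auto simp: finite_dim_def)
    have "complex_vector.independent (B \<inter> weight_space V m)"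
      using B(2) complex_vector.independent_mono by blast
    then show ?thesis using complex_vector.independent_span_bound[OF F(1)] F(2) by blast
  qed
  moreover have "B = (\<Union>m. B \<inter> weight_space V m)" using B(1) by blast
  ultimately have "countable B"
    by (metis countable_UN countable_finite countableI_type)
  \<comment> \<open>Taking the image of the enumeration as index set treats finite and infinite
    bases alike.\<close>
  define I where "I = to_nat_on B ` B"
  define b where "b = inv_into B (to_nat_on B)"
  have bb: "bij_betw b I B"
    unfolding b_def I_def using inj_on_to_nat_on[OF \<open>countable B\<close>]
    by (intro bij_betw_inv_into) (simp add: bij_betw_def)
  then have bI: "b ` I = B" "inj_on b I" by (auto simp: bij_betw_def)
  have "\<exists>m. b i \<in> weight_space V m" if "i \<in> I" for i
    using that bI(1) B(1) by blast
  then obtain \<mu> where \<mu>: "\<And>i. i \<in> I \<Longrightarrow> b i \<in> weight_space V (\<mu> i)" by metis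
  have b: "b i \<in> P 0 \<inter> weight_space V (\<mu> i)" if "i \<in> I" for i
    using \<mu>[OF that] that bI(1) B(1) by blast
  have \<mu>0: "\<mu> i \<noteq> 0" if "i \<in> I" for i
  proof
    assume "\<mu> i = 0"
    then have "b i = 0" using \<mu>[OF that] V0 by simp
    then have "0 \<in> B" using bI(1) that by (metis imageI)
    then show False using B(2) complex_vector.dependent_zero by blast
  qed
  have "s11_iso V (direct_sum I (\<lambda>i. weight_model (\<mu> i)))"
    using b \<mu>0 bI B(2) P0 V0 by (intro s11_iso_direct_sum_of_weight_models[of I b]) auto
  then show ?thesis
    using super_weight_space_model \<mu>0
    by (intro exI[of _ I] exI[of _ "\<lambda>i. weight_model (\<mu> i)"]) blast
qed

text \<open>An even nonzero vector \<open>v0\<close> of weight m and its image under Z span a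
  subrepresentation, because Z^2 is the scalar -m there. Irreducibility makes it the whole space,
  whose parity parts are then the two lines.\<close>

lemma irreducible_super_weight_space:
  assumes irr: "irreducible_rep V" and m: "m \<noteq> 0" and "is_weight V m"
  shows "super_weight_space m V"
proof -
  let ?Z = "rep_alg V gen_Z"
  have ZZ0: "v = 0" if "v \<in> weight_space V m" "?Z v = 0" for v
    using weight_space_ZZ[OF that(1)] that(2) linear_on_zero[OF alg_linear subspace_S] m by simp
  obtain v where v: "v \<in> weight_space V m" "v \<noteq> 0" using assms(3) by (auto simp: is_weight_def)
  obtain x y where xy: "v = x + y" "x \<in> P 0 \<inter> weight_space V m" "y \<in> P 1 \<inter> weight_space V m"
    using weight_space_graded[OF v(1)] .
  \<comment> \<open>If the given weight vector has no even component, Z moves its odd component to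
    an even one, which is nonzero because Z is injective on weight m.\<close>
  have "\<exists>v0. v0 \<noteq> 0 \<and> v0 \<in> P 0 \<inter> weight_space V m"
  proof (cases "x = 0")
    case True
    then have "y \<noteq> 0" using v xy by simp
    moreover have "?Z y \<in> P 0" using Z_P[of y 1] xy(3) by simp
    ultimately show ?thesis using ZZ0[of y] weight_space_Z[of y m] xy(3) by blast
  qed (use xy(2) in blast)
  then obtain v0 where v0: "v0 \<noteq> 0" "v0 \<in> P 0" "v0 \<in> weight_space V m" by blast
  define r where "r = weight_root m"
  have r: "r * r = - of_int m" using weight_root_square[of m] by (simp add: r_def power2_eq_square)
  then have r0: "r \<noteq> 0" using m by auto
  define v1 where "v1 = inverse r *\<^sub>C ?Z v0"
  have v0S: "v0 \<in> S" using v0 P_memD by blast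
  have Zv0: "?Z v0 = r *\<^sub>C v1" using r0 by (simp add: v1_def scaleC_scaleC scaleC_one)
  have Zv1: "?Z v1 = r *\<^sub>C v0"
  proof -
    have "?Z v1 = inverse r *\<^sub>C ?Z (?Z v0)"
      unfolding v1_def by (rule linear_on_scale[OF alg_linear alg_S[OF v0S]])
    also have "?Z (?Z v0) = (r * r) *\<^sub>C v0" unfolding r by (rule weight_space_ZZ[OF v0(3)])
    finally show ?thesis using r0 by (simp add: scaleC_scaleC)
  qed
  have v1P: "v1 \<in> P 1"
    unfolding v1_def using Z_P[OF v0(2)] by (intro complex_vector.subspace_scale[OF subspace_P]) simp
  have v1W: "v1 \<in> weight_space V m"
    unfolding v1_def by (intro complex_vector.subspace_scale[OF subspace_weight_space] weight_space_Z v0)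
  have v10: "v1 \<noteq> 0" using ZZ0[OF v0(3)] v0(1) Zv0 by auto
  define U where "U = complex_vector.span {v0, v1}"
  have U_iff: "u \<in> U \<longleftrightarrow> (\<exists>a b. u = a *\<^sub>C v0 + b *\<^sub>C v1)" for u
    by (auto simp: U_def complex_vector.span_insert algebra_simps)
  have sub_U: "complex_vector.subspace U" by (simp add: U_def complex_vector.subspace_span)
  have UW: "U \<subseteq> weight_space V m"
    unfolding U_def using v0(3) v1W by (intro complex_vector.span_minimal subspace_weight_space) simp
  have US: "U \<subseteq> S" using UW by (auto simp: weight_space_def)
  have sc0: "a *\<^sub>C v0 \<in> P 0" and sc1: "a *\<^sub>C v1 \<in> P 1" for a
    using v0(2) v1P by (auto intro: complex_vector.subspace_scale[OF subspace_P])
  have zP: "0 \<in> P p" for p using complex_vector.subspace_0[OF subspace_P] .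
  have U0: "U \<inter> P 0 = complex_vector.span {v0}"
  proof
    show "complex_vector.span {v0} \<subseteq> U \<inter> P 0"
      using v0(2) complex_vector.span_mono[of "{v0}" "{v0, v1}"]
        complex_vector.span_minimal[OF _ subspace_P[of 0], of "{v0}"] by (auto simp: U_def)
    show "U \<inter> P 0 \<subseteq> complex_vector.span {v0}"
    proof
      fix u assume "u \<in> U \<inter> P 0"
      then obtain a b where u: "u = a *\<^sub>C v0 + b *\<^sub>C v1" "u \<in> P 0" by (auto simp: U_iff)
      have "a *\<^sub>C v0 = u"
        by (rule decomposition_unique(1)[OF sc0 sc1 u(2) zP, of a b]) (simp add: u(1))
      then show "u \<in> complex_vector.span {v0}" by (auto simp: complex_vector.span_singleton)
    qed
  qed
  have U1: "U \<inter> P 1 = complex_vector.span {v1}"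
  proof
    show "complex_vector.span {v1} \<subseteq> U \<inter> P 1"
      using v1P complex_vector.span_mono[of "{v1}" "{v0, v1}"]
        complex_vector.span_minimal[OF _ subspace_P[of 1], of "{v1}"] by (auto simp: U_def)
    show "U \<inter> P 1 \<subseteq> complex_vector.span {v1}"
    proof
      fix u assume "u \<in> U \<inter> P 1"
      then obtain a b where u: "u = a *\<^sub>C v0 + b *\<^sub>C v1" "u \<in> P 1" by (auto simp: U_iff)
      have "b *\<^sub>C v1 = u"
        by (rule decomposition_unique(2)[OF sc0 sc1 zP u(2), of a b]) (simp add: u(1))
      then show "u \<in> complex_vector.span {v1}" by (auto simp: complex_vector.span_singleton)
    qed
  qed
  have "super_space U (\<lambda>p. U \<inter> P p)"
    unfolding super_space_def
  proof (intro conjI allI)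
    show "U = {x + y |x y. x \<in> U \<inter> P 0 \<and> y \<in> U \<inter> P 1}"
      unfolding U0 U1 by (auto simp: U_iff complex_vector.span_singleton; blast)
    show "U \<inter> P 0 \<inter> (U \<inter> P 1) = {0}"
      using P_Int complex_vector.subspace_0[OF sub_U] by blast
  qed (use sub_U subspace_P in \<open>auto intro: complex_vector.subspace_inter\<close>)
  moreover have "rep_alg V X u \<in> U" if uU: "u \<in> U" for X u
  proof -
    \<comment> \<open>Only Z has to be checked: C is a scalar on \<open>U\<close>, and the algebra
      acts by combinations of the two.\<close>
    have "?Z u \<in> U"
    proof -
      obtain a b where u: "u = a *\<^sub>C v0 + b *\<^sub>C v1" using uU by (auto simp: U_iff)
      have v1S: "v1 \<in> S" using v1P by (rule P_memD)
      have "?Z u = (b * r) *\<^sub>C v0 + (a * r) *\<^sub>C v1"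
        using linear_on_add[OF alg_linear, of "a *\<^sub>C v0" "b *\<^sub>C v1" gen_Z]
          linear_on_scale[OF alg_linear v0S] linear_on_scale[OF alg_linear v1S]
          P_memD[OF sc0] P_memD[OF sc1] by (simp add: u Zv0 Zv1 scaleC_scaleC add.commute)
      then show ?thesis unfolding U_iff by blast
    qed
    moreover have "rep_alg V gen_C u = of_int m *\<^sub>C u" using weight_space_C UW that by blast
    ultimately show ?thesis
      using that US alg_eq[of u X] complex_vector.subspace_add[OF sub_U]
        complex_vector.subspace_scale[OF sub_U] by auto
  qed
  moreover have "\<pi> t u \<in> U" if "u \<in> U" "t \<in> S1" for t u
    using that UW complex_vector.subspace_scale[OF sub_U] by (auto simp: weight_space_def subset_iff)
  ultimately have "subrepresentation U V" using US by (simp add: subrepresentation_def)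
  moreover have "v0 \<in> U" by (simp add: U_def complex_vector.span_base)
  ultimately have "U = S" using irr v0(1) by (auto simp: irreducible_rep_def)
  then have P01: "P 0 = complex_vector.span {v0}" "P 1 = complex_vector.span {v1}"
    using U0 U1 P_subset by blast+
  have "complex_vector.dim (P 0) = 1" "complex_vector.dim (P 1) = 1"
    unfolding P01 by (rule dim_span_singleton; fact)+
  moreover have "\<exists>v0 v1 r. r\<^sup>2 = - of_int m \<and> P 0 = complex_vector.span {v0} \<and>
      P 1 = complex_vector.span {v1} \<and> ?Z v0 = r *\<^sub>C v1 \<and> ?Z v1 = r *\<^sub>C v0"
    using P01 Zv0 Zv1 r unfolding power2_eq_square by blast
  ultimately show ?thesis
    using m rep UW \<open>U = S\<close> weight_space_C unfolding super_weight_space_def weight_space_def by blast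
qed

end

theorem theorem6p1:
  fixes V :: "'v::complex_vector s11_rep"
  assumes "s11_representation V"
  shows "(no_trivial_S1_subrep V \<and> (\<forall>m. finite_dim (weight_space V m)) \<longrightarrow>
           (\<exists>(I :: nat set) (W :: nat \<Rightarrow> (complex \<times> complex) s11_rep).
              (\<forall>i\<in>I. \<exists>m. super_weight_space m (W i)) \<and> s11_iso V (direct_sum I W)))
       \<and> (\<forall>m. irreducible_rep V \<and> is_weight V m \<and> m \<noteq> 0 \<longrightarrow> super_weight_space m V)"
proof -
  interpret s11_module V by unfold_locales (rule assms)
  show ?thesis using ex_s11_iso_direct_sum irreducible_super_weight_space by blast
qed

end
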